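(* If $R$ is a PI Krull ring, then the set of lengths $\mathsf L_{R^\bullet}(a)$ is finite and non-empty for all $a\in R^\bullet$.
   Context: All rings are unital. A Krull ring is a prime Goldie ring $R$ that is completely integrally closed (equivalently, $R$ is a maximal order in its quotient ring) and satisfies the ACC on divisorial two-sided ideals. A PI Krull ring is a Krull ring satisfying a polynomial identity; equivalently, it is a maximal order (in the ring-theoretic sense) in a central simple algebra $A$ (finite-dimensional, simple, with center a field $K$) such that the center of $R$ is a commutative Krull domain (with quotient field $K$). $R^\bullet$ is the multiplicative monoid of cancellative elements (non-zero-divisors) of $R$, with unit group $R^\times$. An atom of $R^\bullet$ is a $u\in R^\bullet\setminus R^\times$ such that $u=bc$ with $b,c\in R^\bullet$ implies $b\in R^\times$ or $c\in R^\times$. For $a\in R^\bullet\setminus R^\times$, $\mathsf L_{R^\bullet}(a)$ is the set of all $k\in\mathbb N$ such that $a$ is a product of $k$ atoms of $R^\bullet$; for $a\in R^\times$, $\mathsf L_{R^\bullet}(a)=\{0\}$. *)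

theory Defs
  imports "HOL-Algebra.Ideal" "HOL-Library.Poly_Mapping"
begin

definition acc :: "'a set set \<Rightarrow> bool" where
  "acc F \<longleftrightarrow> (\<forall>A :: nat \<Rightarrow> 'a set. (\<forall>n. A n \<in> F \<and> A n \<subseteq> A (Suc n)) \<longrightarrow>
     (\<exists>n. \<forall>m\<ge>n. A m = A n))"

definition opposite_ring :: "('a, 'm) ring_scheme \<Rightarrow> ('a, 'm) ring_scheme" where
  "opposite_ring R = R\<lparr>mult := (\<lambda>x y. y \<otimes>\<^bsub>R\<^esub> x)\<rparr>"


section \<open>Non-zero-divisors and factorizations\<close>

definition nonzerodivs :: "('a, 'm) ring_scheme \<Rightarrow> 'a set" where
  "nonzerodivs R = {a \<in> carrier R. \<forall>x \<in> carrier R.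
     (a \<otimes>\<^bsub>R\<^esub> x = \<zero>\<^bsub>R\<^esub> \<longrightarrow> x = \<zero>\<^bsub>R\<^esub>) \<and> (x \<otimes>\<^bsub>R\<^esub> a = \<zero>\<^bsub>R\<^esub> \<longrightarrow> x = \<zero>\<^bsub>R\<^esub>)}"

definition regular_monoid :: "('a, 'm) ring_scheme \<Rightarrow> 'a monoid" where
  "regular_monoid R =
     \<lparr>carrier = nonzerodivs R, mult = mult R, one = \<one>\<^bsub>R\<^esub>\<rparr>"

text \<open>The library's \<open>irreducible\<close> and \<open>factors\<close> are based on one-sided divisibility and are
  aimed at commutative monoids, so atoms of a noncommutative monoid are defined directly.\<close>

definition atoms :: "('a, 'm) monoid_scheme \<Rightarrow> 'a set" where
  "atoms M = {u \<in> carrier M - Units M. \<forall>b \<in> carrier M. \<forall>c \<in> carrier M.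
     u = b \<otimes>\<^bsub>M\<^esub> c \<longrightarrow> b \<in> Units M \<or> c \<in> Units M}"

definition set_of_lengths :: "('a, 'm) monoid_scheme \<Rightarrow> 'a \<Rightarrow> nat set" where
  "set_of_lengths M a =
     (if a \<in> Units M then {0}
      else {length us |us. set us \<subseteq> atoms M \<and> a = foldr (mult M) us \<one>\<^bsub>M\<^esub>})"


section \<open>Prime Goldie rings\<close>

definition prime_ring :: "('a, 'm) ring_scheme \<Rightarrow> bool" where
  "prime_ring R \<longleftrightarrow> ring R \<and> \<one>\<^bsub>R\<^esub> \<noteq> \<zero>\<^bsub>R\<^esub> \<and>
     (\<forall>I J. ideal I R \<and> ideal J R \<and> (\<forall>a \<in> I. \<forall>b \<in> J. a \<otimes>\<^bsub>R\<^esub> b = \<zero>\<^bsub>R\<^esub>)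
        \<longrightarrow> I = {\<zero>\<^bsub>R\<^esub>} \<or> J = {\<zero>\<^bsub>R\<^esub>})"

definition right_ideal :: "'a set \<Rightarrow> ('a, 'm) ring_scheme \<Rightarrow> bool" where
  "right_ideal I R \<longleftrightarrow> additive_subgroup I R \<and> (\<forall>a \<in> I. \<forall>r \<in> carrier R. a \<otimes>\<^bsub>R\<^esub> r \<in> I)"

definition right_annihilator :: "('a, 'm) ring_scheme \<Rightarrow> 'a set \<Rightarrow> 'a set" where
  "right_annihilator R X = {r \<in> carrier R. \<forall>x \<in> X. x \<otimes>\<^bsub>R\<^esub> r = \<zero>\<^bsub>R\<^esub>}"

definition independent_family :: "('a, 'm) ring_scheme \<Rightarrow> (nat \<Rightarrow> 'a set) \<Rightarrow> bool" where
  "independent_family R I \<longleftrightarrow>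
     (\<forall>n x. (\<forall>k<n. x k \<in> I k) \<and> finsum R x {..<n} = \<zero>\<^bsub>R\<^esub> \<longrightarrow> (\<forall>k<n. x k = \<zero>\<^bsub>R\<^esub>))"

definition right_goldie :: "('a, 'm) ring_scheme \<Rightarrow> bool" where
  "right_goldie R \<longleftrightarrow> ring R \<and>
     \<not> (\<exists>I. (\<forall>n. right_ideal (I n) R \<and> I n \<noteq> {\<zero>\<^bsub>R\<^esub>}) \<and> independent_family R I) \<and>
     acc {right_annihilator R X |X. X \<subseteq> carrier R}"

definition goldie :: "('a, 'm) ring_scheme \<Rightarrow> bool" where
  "goldie R \<longleftrightarrow> right_goldie R \<and> right_goldie (opposite_ring R)"


section \<open>Quotient rings and divisorial ideals\<close>

definition quotient_ring ::
    "('a, 'm) ring_scheme \<Rightarrow> ('b, 'n) ring_scheme \<Rightarrow> ('a \<Rightarrow> 'b) \<Rightarrow> bool" where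
  "quotient_ring R Q \<iota> \<longleftrightarrow> ring Q \<and> \<iota> \<in> ring_hom R Q \<and> inj_on \<iota> (carrier R) \<and>
     \<iota> ` nonzerodivs R \<subseteq> Units Q \<and>
     (\<forall>q \<in> carrier Q. \<exists>a \<in> carrier R. \<exists>s \<in> nonzerodivs R. q = \<iota> a \<otimes>\<^bsub>Q\<^esub> inv\<^bsub>Q\<^esub> (\<iota> s)) \<and>
     (\<forall>q \<in> carrier Q. \<exists>a \<in> carrier R. \<exists>s \<in> nonzerodivs R. q = inv\<^bsub>Q\<^esub> (\<iota> s) \<otimes>\<^bsub>Q\<^esub> \<iota> a)"

text \<open>For subsets of a ring \<open>Q\<close>: \<open>left_quot Q X Y\<close> is \<open>(X :\<^sub>l Y) = {q \<in> Q. qY \<subseteq> X}\<close>, and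
  \<open>right_quot Q X Y\<close> is \<open>(X :\<^sub>r Y) = {q \<in> Q. Yq \<subseteq> X}\<close>.\<close>

definition left_quot :: "('b, 'n) ring_scheme \<Rightarrow> 'b set \<Rightarrow> 'b set \<Rightarrow> 'b set" where
  "left_quot Q X Y = {q \<in> carrier Q. \<forall>y \<in> Y. q \<otimes>\<^bsub>Q\<^esub> y \<in> X}"

definition right_quot :: "('b, 'n) ring_scheme \<Rightarrow> 'b set \<Rightarrow> 'b set \<Rightarrow> 'b set" where
  "right_quot Q X Y = {q \<in> carrier Q. \<forall>y \<in> Y. y \<otimes>\<^bsub>Q\<^esub> q \<in> X}"

text \<open>In the next two definitions \<open>S\<close> is (the carrier of) an order in its quotient ring \<open>Q\<close>, and
  ideals of \<open>S\<close> are ideals of the subring \<open>Q\<lparr>carrier := S\<rparr>\<close>.  A prime Goldie ring is completely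
  integrally closed if both the left and the right order of every nonzero ideal equal \<open>S\<close>.\<close>

definition completely_integrally_closed :: "('b, 'n) ring_scheme \<Rightarrow> 'b set \<Rightarrow> bool" where
  "completely_integrally_closed Q S \<longleftrightarrow>
     (\<forall>I. ideal I (Q\<lparr>carrier := S\<rparr>) \<and> I \<noteq> {\<zero>\<^bsub>Q\<^esub>} \<longrightarrow> left_quot Q I I = S \<and> right_quot Q I I = S)"

definition divisorial_ideal :: "('b, 'n) ring_scheme \<Rightarrow> 'b set \<Rightarrow> 'b set \<Rightarrow> bool" where
  "divisorial_ideal Q S I \<longleftrightarrow> ideal I (Q\<lparr>carrier := S\<rparr>) \<and> I \<noteq> {\<zero>\<^bsub>Q\<^esub>} \<and>
     left_quot Q S (right_quot Q S I) = I \<and> right_quot Q S (left_quot Q S I) = I"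


section \<open>PI Krull rings\<close>

text \<open>The quotient ring of a prime Goldie ring exists by Goldie's theorem and is unique up to
  isomorphism over \<open>R\<close>. Being an Ore localization, its elements are classes of pairs of elements
  of \<open>R\<close>, so quantifying over rings on the type \<open>('a \<times> 'a) set\<close> is no restriction.\<close>

definition krull_ring :: "('a, 'm) ring_scheme \<Rightarrow> bool" where
  "krull_ring R \<longleftrightarrow> prime_ring R \<and> goldie R \<and>
     (\<exists>(Q :: ('a \<times> 'a) set ring) \<iota>. quotient_ring R Q \<iota> \<and>
        completely_integrally_closed Q (\<iota> ` carrier R) \<and>
        acc {I. divisorial_ideal Q (\<iota> ` carrier R) I})"

text \<open>An element of the free ring \<open>\<int>\<langle>X\<^sub>0, X\<^sub>1, \<dots>\<rangle>\<close> is represented by its finitely supported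
  coefficient function on words in the indices of the variables. A polynomial identity is
  required to be monic: some monomial of maximal degree has coefficient \<open>1\<close>.\<close>

type_synonym nc_poly = "nat list \<Rightarrow>\<^sub>0 int"

definition nc_eval :: "('a, 'm) ring_scheme \<Rightarrow> (nat \<Rightarrow> 'a) \<Rightarrow> nc_poly \<Rightarrow> 'a" where
  "nc_eval R x f = finsum R
     (\<lambda>w. [Poly_Mapping.lookup f w] \<cdot>\<^bsub>R\<^esub> foldr (mult R) (map x w) \<one>\<^bsub>R\<^esub>) (Poly_Mapping.keys f)"

definition nc_monic :: "nc_poly \<Rightarrow> bool" where
  "nc_monic f \<longleftrightarrow> (\<exists>w \<in> Poly_Mapping.keys f. Poly_Mapping.lookup f w = 1 \<and>
     (\<forall>v \<in> Poly_Mapping.keys f. length v \<le> length w))"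

definition pi_ring :: "('a, 'm) ring_scheme \<Rightarrow> bool" where
  "pi_ring R \<longleftrightarrow> ring R \<and>
     (\<exists>f. nc_monic f \<and> (\<forall>x. range x \<subseteq> carrier R \<longrightarrow> nc_eval R x f = \<zero>\<^bsub>R\<^esub>))"

definition pi_krull_ring :: "('a, 'm) ring_scheme \<Rightarrow> bool" where
  "pi_krull_ring R \<longleftrightarrow> krull_ring R \<and> pi_ring R"


section \<open>Basic facts\<close>

lemma nonzerodivsI:
  assumes "a \<in> carrier R"
    and "\<And>x. x \<in> carrier R \<Longrightarrow> a \<otimes>\<^bsub>R\<^esub> x = \<zero>\<^bsub>R\<^esub> \<Longrightarrow> x = \<zero>\<^bsub>R\<^esub>"
    and "\<And>x. x \<in> carrier R \<Longrightarrow> x \<otimes>\<^bsub>R\<^esub> a = \<zero>\<^bsub>R\<^esub> \<Longrightarrow> x = \<zero>\<^bsub>R\<^esub>"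
  shows "a \<in> nonzerodivs R"
  using assms unfolding nonzerodivs_def by blast

lemma nonzerodivsD:
  assumes "a \<in> nonzerodivs R"
  shows "a \<in> carrier R"
    and "x \<in> carrier R \<Longrightarrow> a \<otimes>\<^bsub>R\<^esub> x = \<zero>\<^bsub>R\<^esub> \<Longrightarrow> x = \<zero>\<^bsub>R\<^esub>"
    and "x \<in> carrier R \<Longrightarrow> x \<otimes>\<^bsub>R\<^esub> a = \<zero>\<^bsub>R\<^esub> \<Longrightarrow> x = \<zero>\<^bsub>R\<^esub>"
  using assms unfolding nonzerodivs_def by blast+

lemma (in ring) Units_subset_nonzerodivs: "Units R \<subseteq> nonzerodivs R"
proof
  fix u assume u: "u \<in> Units R"
  then have c: "u \<in> carrier R" "inv u \<in> carrier R" by auto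
  have "x = \<zero>" if "x \<in> carrier R" "u \<otimes> x = \<zero>" for x
  proof -
    have "inv u \<otimes> u \<otimes> x = inv u \<otimes> (u \<otimes> x)" using that c by (intro m_assoc)
    then show ?thesis using that c u by simp
  qed
  moreover have "x = \<zero>" if "x \<in> carrier R" "x \<otimes> u = \<zero>" for x
  proof -
    have "x \<otimes> u \<otimes> inv u = x \<otimes> (u \<otimes> inv u)" using that c by (intro m_assoc)
    then show ?thesis using that c u by simp
  qed
  ultimately show "u \<in> nonzerodivs R" using c by (intro nonzerodivsI)
qed

lemma (in ring) Units_regular_monoid: "Units (regular_monoid R) = Units R"
proof -
  have "Units (regular_monoid R) \<subseteq> Units R"
    using nonzerodivsD(1)[of _ R] by (auto simp: Units_def regular_monoid_def)
  moreover have "u \<in> Units (regular_monoid R)" if u: "u \<in> Units R" for u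
  proof -
    have "u \<in> nonzerodivs R" "inv u \<in> nonzerodivs R"
      using u Units_subset_nonzerodivs by auto
    then show ?thesis
      using Units_l_inv[OF u] Units_r_inv[OF u] unfolding Units_def[of "regular_monoid R"]
      by (auto simp: regular_monoid_def simp del: Units_l_inv Units_r_inv
          intro!: bexI[of _ "inv u"])
  qed
  ultimately show ?thesis by blast
qed

lemma (in ring) monoid_regular_monoid: "monoid (regular_monoid R)"
proof -
  have "a \<otimes> b \<in> nonzerodivs R" if a: "a \<in> nonzerodivs R" and b: "b \<in> nonzerodivs R" for a b
  proof (rule nonzerodivsI)
    note c = nonzerodivsD(1)[OF a] nonzerodivsD(1)[OF b]
    show "a \<otimes> b \<in> carrier R" using c by (rule m_closed)
    fix x assume x: "x \<in> carrier R"
    show "x = \<zero>" if "a \<otimes> b \<otimes> x = \<zero>"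
      by (rule nonzerodivsD(2)[OF b x], rule nonzerodivsD(2)[OF a])
        (use that c x in \<open>simp_all add: m_assoc\<close>)
    show "x = \<zero>" if "x \<otimes> (a \<otimes> b) = \<zero>"
      by (rule nonzerodivsD(3)[OF a x], rule nonzerodivsD(3)[OF b])
        (use that c x in \<open>simp_all add: m_assoc\<close>)
  qed
  moreover have "\<one> \<in> nonzerodivs R" using Units_subset_nonzerodivs by blast
  ultimately show ?thesis
    by (intro monoidI) (simp_all add: regular_monoid_def nonzerodivsD(1) m_assoc)
qed

end

(* The elements u_1, ..., u_k of a factorization of a yield the chain of right ideals
   u_1 ... u_i R between R and aR, strictly decreasing if no u_i is a unit. Such right ideals are closed
   in the sense that they contain every x with xN in them for an ideal N whose divisorial closure is R,
   and the point is to bound the lengths of chains of closed right ideals above aR.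

   A multilinear identity shows that aR contains a nonzero ideal, hence a divisorial ideal I, because aR
   is closed. The same argument modulo a maximal divisorial ideal P shows that chains of closed right ideals
   above P have at most as many steps as the degree of the identity. For arbitrary divisorial I contained in P,
   the ideal C = {x. Px <= I} is divisorial and strictly larger than I. A chain J_i above I
   induces chains above C (the closures of J_i + C) and above P (the right ideals {x. xC <= J_i}), and
   each proper step of J_i is a proper step in one of them. So the bound follows by Noetherian
   induction on divisorial ideals, without any structure theory of PI algebras. *)

theory Submission
  imports Defs "HOL-Algebra.Subrings" "HOL-Library.Infinite_Set"
begin

text \<open>Arbitrary right ideals above \<open>aR\<close> admit no bound: in the polynomial ring
  k[x,y] the ideals (x, y^n) descend forever above (x). Their dual is the whole ring, so restricting
  to closed right ideals removes such chains. Principal right ideals of regular elements survive,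
  because \<open>absorbed\<close> tests against elements q of the quotient ring, among them inv a x.
  A nonzero ideal C need not be invertible. Complete integral closure supplies a substitute: if q
  maps the dual of C into itself, then q lies in the order. This lets factors from C and its dual be
  inserted and stripped when closedness is moved between J and {x. xC <= J}. The identity enters
  only through \<open>absorbing\<close>, which speaks of products and right ideals and hence passes
  easily to the image of R in its quotient ring; \<open>d\<close> is the degree of the leading
  monomial. Factorizations into nonunits are bounded, rather than factorizations into atoms: the
  existence of an atomic factorization then comes from a longest one.\<close>

section \<open>Multilinear identities\<close>

text \<open>The form in which the identity is used, with \<open>K\<close> the zero ideal (to find
  ideals inside principal right ideals) or a maximal divisorial ideal (to bound chains). The
  condition on \<open>t j\<close> for \<open>j > k\<close> is a triangularity that singles out one
  monomial. The factor \<open>r\<close> makes the elements \<open>g\<close> with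
  \<open>t k R g \<subseteq> T k\<close> a two-sided ideal.\<close>

definition absorbing :: "('a, 'm) ring_scheme \<Rightarrow> nat \<Rightarrow> bool" where
  "absorbing R d \<longleftrightarrow> (\<forall>t T K. (\<forall>k<d. t k \<in> carrier R \<and> right_ideal (T k) R \<and> K \<subseteq> T k \<and>
       (\<forall>j<d. k < j \<longrightarrow> t j \<in> T k)) \<and> \<zero>\<^bsub>R\<^esub> \<in> K \<and> \<one>\<^bsub>R\<^esub> \<notin> K \<longrightarrow>
     (\<exists>k<d. \<exists>g\<in>carrier R - K. \<forall>r\<in>carrier R. t k \<otimes>\<^bsub>R\<^esub> r \<otimes>\<^bsub>R\<^esub> g \<in> T k))"

lemma absorbingI:
  fixes R (structure)
  assumes "\<And>t T K. \<lbrakk>\<And>k. k < d \<Longrightarrow> t k \<in> carrier R; \<And>k. k < d \<Longrightarrow> right_ideal (T k) R;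
      \<And>k. k < d \<Longrightarrow> K \<subseteq> T k; \<And>k j. k < j \<Longrightarrow> j < d \<Longrightarrow> t j \<in> T k; \<zero> \<in> K; \<one> \<notin> K\<rbrakk> \<Longrightarrow>
      \<exists>k<d. \<exists>g\<in>carrier R - K. \<forall>r\<in>carrier R. t k \<otimes> r \<otimes> g \<in> T k"
  shows "absorbing R d"
  unfolding absorbing_def
proof (intro allI impI)
  fix t T K
  assume "(\<forall>k<d. t k \<in> carrier R \<and> right_ideal (T k) R \<and> K \<subseteq> T k \<and>
    (\<forall>j<d. k < j \<longrightarrow> t j \<in> T k)) \<and> \<zero> \<in> K \<and> \<one> \<notin> K"
  then have h: "\<forall>k<d. t k \<in> carrier R" "\<forall>k<d. right_ideal (T k) R" "\<forall>k<d. K \<subseteq> T k"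
    "\<forall>k<d. \<forall>j<d. k < j \<longrightarrow> t j \<in> T k" "\<zero> \<in> K" "\<one> \<notin> K" by simp_all
  show "\<exists>k<d. \<exists>g\<in>carrier R - K. \<forall>r\<in>carrier R. t k \<otimes> r \<otimes> g \<in> T k"
  proof (rule assms)
    show "t j \<in> T k" if "k < j" "j < d" for k j using h(4) that less_trans by blast
  qed (use h in simp_all)
qed

lemma absorbingD:
  fixes R (structure)
  assumes "absorbing R d" "\<And>k. k < d \<Longrightarrow> t k \<in> carrier R" "\<And>k. k < d \<Longrightarrow> right_ideal (T k) R"
    "\<And>k. k < d \<Longrightarrow> K \<subseteq> T k" "\<And>k j. k < j \<Longrightarrow> j < d \<Longrightarrow> t j \<in> T k" "\<zero> \<in> K" "\<one> \<notin> K"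
  shows "\<exists>k<d. \<exists>g\<in>carrier R - K. \<forall>r\<in>carrier R. t k \<otimes> r \<otimes> g \<in> T k"
proof -
  have "(\<forall>k<d. t k \<in> carrier R \<and> right_ideal (T k) R \<and> K \<subseteq> T k \<and>
    (\<forall>j<d. k < j \<longrightarrow> t j \<in> T k)) \<and> \<zero> \<in> K \<and> \<one> \<notin> K"
    using assms(2-7) by (intro conjI allI impI)
  then show ?thesis using assms(1) unfolding absorbing_def by blast
qed

section \<open>Evaluation of noncommutative polynomials and multilinearization\<close>

context ring
begin

lemma int_pow_zero: "[(0 :: int)] \<cdot> x = \<zero>"
  by (simp add: add_pow_int_ge)

text \<open>A Horner scheme that splits off the first letter, so the part of a polynomial behind a
  given prefix is again a value of \<open>word_eval\<close>. Only words of length at most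
  \<open>n\<close> in letters below \<open>d\<close> are evaluated; elsewhere \<open>c\<close> is
  arbitrary.\<close>

primrec word_eval :: "(nat \<Rightarrow> 'a) \<Rightarrow> nat \<Rightarrow> nat \<Rightarrow> (nat list \<Rightarrow> int) \<Rightarrow> 'a" where
  "word_eval y d 0 c = [c []] \<cdot> \<one>"
| "word_eval y d (Suc n) c =
     [c []] \<cdot> \<one> \<oplus> (\<Oplus>j\<in>{..<d}. y j \<otimes> word_eval y d n (\<lambda>u. c (j # u)))"

lemma word_eval_closed:
  assumes "range y \<subseteq> carrier R"
  shows "word_eval y d n c \<in> carrier R"
  using assms by (induction n arbitrary: c) (auto simp: image_subset_iff intro!: finsum_closed)

lemma word_eval_add:
  assumes "range y \<subseteq> carrier R"
  shows "word_eval y d n (\<lambda>u. c u + c' u) = word_eval y d n c \<oplus> word_eval y d n c'"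
proof (induction n arbitrary: c c')
  case 0
  then show ?case by (simp add: add.int_pow_mult)
next
  case (Suc n)
  let ?s = "\<lambda>c. \<Oplus>j\<in>{..<d}. y j \<otimes> word_eval y d n (\<lambda>u. c (j # u))"
  have y: "y j \<in> carrier R" for j using assms by auto
  have s: "?s c \<in> carrier R" for c
    using y word_eval_closed[OF assms] by (auto intro!: finsum_closed)
  have "(\<Oplus>j\<in>{..<d}. y j \<otimes> word_eval y d n (\<lambda>u. c (j # u) + c' (j # u))) =
      (\<Oplus>j\<in>{..<d}. y j \<otimes> word_eval y d n (\<lambda>u. c (j # u)) \<oplus>
        y j \<otimes> word_eval y d n (\<lambda>u. c' (j # u)))"
    using y word_eval_closed[OF assms] by (simp add: Suc.IH r_distr)
  also have "\<dots> = ?s c \<oplus> ?s c'"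
    using y word_eval_closed[OF assms] by (intro finsum_addf) auto
  finally have "word_eval y d (Suc n) (\<lambda>u. c u + c' u) =
      ([c []] \<cdot> \<one> \<oplus> [c' []] \<cdot> \<one>) \<oplus> (?s c \<oplus> ?s c')"
    by (simp add: add.int_pow_mult)
  also have "\<dots> = ([c []] \<cdot> \<one> \<oplus> ?s c) \<oplus> ([c' []] \<cdot> \<one> \<oplus> ?s c')"
    using s[of c] s[of c'] by (simp add: a_ac)
  finally show ?case by simp
qed

lemma word_eval_zero:
  assumes "range y \<subseteq> carrier R"
    and "\<And>u. length u \<le> n \<Longrightarrow> set u \<subseteq> {..<d} \<Longrightarrow> c u = 0"
  shows "word_eval y d n c = \<zero>"
  using assms(2)
proof (induction n arbitrary: c)
  case 0
  then show ?case by (simp add: int_pow_zero)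
next
  case (Suc n)
  have "word_eval y d n (\<lambda>u. c (j # u)) = \<zero>" if "j < d" for j
    using that by (intro Suc.IH Suc.prems) auto
  then have "(\<Oplus>j\<in>{..<d}. y j \<otimes> word_eval y d n (\<lambda>u. c (j # u))) = \<zero>"
    using assms(1) by (intro add.finprod_one_eqI) (auto simp: image_subset_iff)
  moreover have "c [] = 0" using Suc.prems by simp
  ultimately show ?case by (simp add: int_pow_zero)
qed

text \<open>A letter at which \<open>y\<close> and \<open>y'\<close> differ occurs in no word with
  nonzero coefficient, so the branch below it vanishes on both sides.\<close>

lemma word_eval_cong:
  assumes "range y \<subseteq> carrier R" "range y' \<subseteq> carrier R"
    and "\<And>u. length u \<le> n \<Longrightarrow> set u \<subseteq> {..<d} \<Longrightarrow>
      c u = c' u \<and> (c u \<noteq> 0 \<longrightarrow> (\<forall>j\<in>set u. y j = y' j))"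
  shows "word_eval y d n c = word_eval y' d n c'"
  using assms(3)
proof (induction n arbitrary: c c')
  case 0
  then show ?case by simp
next
  case (Suc n)
  have "y j \<otimes> word_eval y d n (\<lambda>u. c (j # u)) = y' j \<otimes> word_eval y' d n (\<lambda>u. c' (j # u))"
    if "j < d" for j
  proof (cases "y j = y' j")
    case True
    have "word_eval y d n (\<lambda>u. c (j # u)) = word_eval y' d n (\<lambda>u. c' (j # u))"
    proof (rule Suc.IH)
      fix u :: "nat list"
      assume "length u \<le> n" "set u \<subseteq> {..<d}"
      then show "c (j # u) = c' (j # u) \<and> (c (j # u) \<noteq> 0 \<longrightarrow> (\<forall>j\<in>set u. y j = y' j))"
        using that Suc.prems[of "j # u"] by auto
    qed
    then show ?thesis using True by simp
  next
    case False
    have "c (j # u) = 0" "c' (j # u) = 0" if "length u \<le> n" "set u \<subseteq> {..<d}" for u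
      using that False \<open>j < d\<close> Suc.prems[of "j # u"] by auto
    then have "word_eval y d n (\<lambda>u. c (j # u)) = \<zero>" "word_eval y' d n (\<lambda>u. c' (j # u)) = \<zero>"
      by (intro word_eval_zero assms(1,2); blast)+
    then show ?thesis using assms(1,2) by (auto simp: image_subset_iff)
  qed
  then have "(\<Oplus>j\<in>{..<d}. y j \<otimes> word_eval y d n (\<lambda>u. c (j # u))) =
      (\<Oplus>j\<in>{..<d}. y' j \<otimes> word_eval y' d n (\<lambda>u. c' (j # u)))"
    using assms(2) word_eval_closed[OF assms(2)]
    by (intro finsum_cong') (auto simp: image_subset_iff)
  moreover have "c [] = c' []" using Suc.prems by simp
  ultimately show ?case by simp
qed

lemma word_eval_eq_finsum:
  assumes "range x \<subseteq> carrier R"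
  shows "word_eval x m n c =
    (\<Oplus>v\<in>{v. set v \<subseteq> {..<m} \<and> length v \<le> n}. [c v] \<cdot> foldr (\<otimes>) (map x v) \<one>)"
proof (induction n arbitrary: c)
  case 0
  have "{v. set v \<subseteq> {..<m} \<and> length v \<le> 0} = {[]}" by auto
  then show ?case by (simp add: finsum_insert finsum_empty)
next
  case (Suc n)
  define W where "W n = {v. set v \<subseteq> {..<m} \<and> length v \<le> n}" for n
  have W: "finite (W n)" for n
    using finite_lists_length_le[of "{..<m}" n] by (simp add: W_def)
  have x: "x i \<in> carrier R" for i using assms by auto
  have mon: "foldr (\<otimes>) (map x v) \<one> \<in> carrier R" for v by (induction v) (use x in auto)
  let ?t = "\<lambda>v. [c v] \<cdot> foldr (\<otimes>) (map x v) \<one>"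
  have "W (Suc n) = insert [] (\<Union>j\<in>{..<m}. (#) j ` W n)"
  proof (rule Set.set_eqI)
    fix v show "v \<in> W (Suc n) \<longleftrightarrow> v \<in> insert [] (\<Union>j\<in>{..<m}. (#) j ` W n)"
      by (cases v) (auto simp: W_def)
  qed
  then have "finsum R ?t (W (Suc n)) = ?t [] \<oplus> finsum R ?t (\<Union>j\<in>{..<m}. (#) j ` W n)"
    using W mon by (simp add: finsum_insert image_iff)
  also have "finsum R ?t (\<Union>j\<in>{..<m}. (#) j ` W n) = (\<Oplus>j\<in>{..<m}. finsum R ?t ((#) j ` W n))"
    using W mon by (intro add.finprod_UN_disjoint) (auto simp: pairwise_def disjnt_def)
  also have "\<dots> = (\<Oplus>j\<in>{..<m}. x j \<otimes> word_eval x m n (\<lambda>u. c (j # u)))"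
  proof (rule finsum_cong')
    fix j
    have "finsum R ?t ((#) j ` W n) = (\<Oplus>v\<in>W n. ?t (j # v))"
      using mon by (intro finsum_reindex) auto
    also have "\<dots> = (\<Oplus>v\<in>W n. x j \<otimes> ([c (j # v)] \<cdot> foldr (\<otimes>) (map x v) \<one>))"
      using mon x by (simp add: add_pow_rdistr_int)
    also have "\<dots> = x j \<otimes> (\<Oplus>v\<in>W n. [c (j # v)] \<cdot> foldr (\<otimes>) (map x v) \<one>)"
      using W mon x by (intro finsum_rdistr[symmetric]) auto
    also have "\<dots> = x j \<otimes> word_eval x m n (\<lambda>u. c (j # u))" by (simp add: Suc.IH W_def)
    finally show "finsum R ?t ((#) j ` W n) = \<dots>" .
  qed (use x word_eval_closed[OF assms] in auto)
  finally show ?case by (simp add: W_def)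
qed

text \<open>When the sums are multiplied out, each word \<open>u\<close> in the \<open>y p\<close>
  arises exactly once, from the word \<open>map w u\<close>, and inherits its coefficient.\<close>

lemma word_eval_linear_subst:
  assumes y: "range y \<subseteq> carrier R" and w: "\<And>p. p < d \<Longrightarrow> w p < m"
  shows "word_eval (\<lambda>i. \<Oplus>p\<in>{p\<in>{..<d}. w p = i}. y p) m n c =
    word_eval y d n (\<lambda>u. c (map w u))"
proof (induction n arbitrary: c)
  case 0
  then show ?case by simp
next
  case (Suc n)
  define x where "x i = (\<Oplus>p\<in>{p\<in>{..<d}. w p = i}. y p)" for i
  have y': "y p \<in> carrier R" for p using y by auto
  let ?G = "\<lambda>i. word_eval y d n (\<lambda>u. c (i # map w u))"
  have G: "?G i \<in> carrier R" for i by (rule word_eval_closed[OF y])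
  have "(\<Oplus>i\<in>{..<m}. x i \<otimes> ?G i) =
      (\<Oplus>i\<in>{..<m}. (\<Oplus>p\<in>{p\<in>{..<d}. w p = i}. y p \<otimes> ?G (w p)))"
  proof (rule finsum_cong')
    fix i
    have "x i \<otimes> ?G i = (\<Oplus>p\<in>{p\<in>{..<d}. w p = i}. y p \<otimes> ?G i)"
      unfolding x_def using y' G by (intro finsum_ldistr) auto
    also have "\<dots> = (\<Oplus>p\<in>{p\<in>{..<d}. w p = i}. y p \<otimes> ?G (w p))"
      using y' G by (intro finsum_cong') auto
    finally show "x i \<otimes> ?G i = \<dots>" .
  qed (use y' G in \<open>auto intro!: finsum_closed\<close>)
  also have "\<dots> = (\<Oplus>p\<in>(\<Union>i\<in>{..<m}. {p\<in>{..<d}. w p = i}). y p \<otimes> ?G (w p))"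
    using y' G by (intro add.finprod_UN_disjoint[symmetric]) (auto simp: pairwise_def disjnt_def)
  also have "(\<Union>i\<in>{..<m}. {p\<in>{..<d}. w p = i}) = {..<d}" using w by auto
  finally show ?case using Suc.IH[of "\<lambda>u. c (_ # u)"] by (simp add: x_def)
qed

lemma word_eval_zero_variable:
  assumes "range y \<subseteq> carrier R" "y p = \<zero>"
    and "\<And>u. p \<notin> set u \<Longrightarrow> c u = c' u"
  shows "word_eval y d n c = word_eval y d n c'"
  using assms(3)
proof (induction n arbitrary: c c')
  case 0
  then show ?case by simp
next
  case (Suc n)
  have y: "y j \<in> carrier R" for j using assms(1) by auto
  have "y j \<otimes> word_eval y d n (\<lambda>u. c (j # u)) = y j \<otimes> word_eval y d n (\<lambda>u. c' (j # u))" for j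
  proof (cases "j = p")
    case True
    then show ?thesis using assms(2) word_eval_closed[OF assms(1)] by simp
  next
    case False
    then have "word_eval y d n (\<lambda>u. c (j # u)) = word_eval y d n (\<lambda>u. c' (j # u))"
      by (intro Suc.IH Suc.prems) auto
    then show ?thesis by simp
  qed
  moreover have "c [] = c' []" using Suc.prems by simp
  ultimately show ?case by simp
qed

text \<open>Let \<open>w\<close> be the leading monomial and substitute for \<open>x\<^sub>i\<close> the sum of the \<open>y\<^sub>p\<close> over the positions
  \<open>p\<close> of the letter \<open>i\<close> in \<open>w\<close>. Then \<open>y\<^sub>0 \<dots> y\<^sub>d\<^sub>-\<^sub>1\<close> inherits the coefficient of \<open>w\<close>. Setting the
  variables to \<open>0\<close> one after the other isolates the words in which all of them occur.\<close>

lemma pi_ring_multilinear_identity: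
  assumes "pi_ring R"
  obtains d c where "c [0..<d] = 1" "\<And>u. \<not> {..<d} \<subseteq> set u \<Longrightarrow> c u = 0"
    and "\<And>y. range y \<subseteq> carrier R \<Longrightarrow> word_eval y d d c = \<zero>"
proof -
  obtain f where f: "nc_monic f" "\<And>x. range x \<subseteq> carrier R \<Longrightarrow> nc_eval R x f = \<zero>"
    using assms unfolding pi_ring_def by blast
  then obtain w where w: "w \<in> Poly_Mapping.keys f" "Poly_Mapping.lookup f w = 1"
      "\<And>v. v \<in> Poly_Mapping.keys f \<Longrightarrow> length v \<le> length w"
    unfolding nc_monic_def by blast
  define d where "d = length w"
  have "finite (\<Union>v\<in>Poly_Mapping.keys f. set v)" by simp
  \<comment> \<open>\<open>m\<close> bounds the variables of \<open>f\<close> and \<open>d\<close>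
    the lengths of its words, so \<open>f\<close> becomes a sum over a finite set of words that
    \<open>word_eval\<close> covers.\<close>
  then obtain m where m: "\<And>v i. v \<in> Poly_Mapping.keys f \<Longrightarrow> i \<in> set v \<Longrightarrow> i < m"
    unfolding finite_nat_set_iff_bounded by blast
  define c0 where "c0 u = Poly_Mapping.lookup f (map ((!) w) u)" for u
  have c0: "word_eval y d d c0 = \<zero>" if y: "range y \<subseteq> carrier R" for y
  proof -
    define x where "x i = (\<Oplus>p\<in>{p\<in>{..<d}. w ! p = i}. y p)" for i
    have x: "range x \<subseteq> carrier R" using y by (auto simp: x_def intro!: finsum_closed)
    have mon: "foldr (\<otimes>) (map x v) \<one> \<in> carrier R" for v by (induction v) (use x in auto)
    have "\<zero> = nc_eval R x f" using f(2)[OF x] by simp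
    also have "\<dots> = (\<Oplus>v\<in>{v. set v \<subseteq> {..<m} \<and> length v \<le> d}.
        [Poly_Mapping.lookup f v] \<cdot> foldr (\<otimes>) (map x v) \<one>)"
      unfolding nc_eval_def
    proof (rule add.finprod_mono_neutral_cong_left)
      show "finite {v. set v \<subseteq> {..<m} \<and> length v \<le> d}" by (rule finite_lists_length_le) simp
      show "Poly_Mapping.keys f \<subseteq> {v. set v \<subseteq> {..<m} \<and> length v \<le> d}"
        using m w(3) by (auto simp: d_def)
    qed (use mon in \<open>auto simp: int_pow_zero in_keys_iff\<close>)
    also have "\<dots> = word_eval x m d (Poly_Mapping.lookup f)"
      by (rule word_eval_eq_finsum[OF x, symmetric])
    also have "\<dots> = word_eval y d d c0"
      unfolding x_def c0_def
      by (rule word_eval_linear_subst[OF y]) (use m[OF w(1)] in \<open>simp add: d_def\<close>)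
    finally show ?thesis by simp
  qed
  \<comment> \<open>Among words of length at most \<open>d\<close>, those containing all letters
    below \<open>d\<close> are permutations, so \<open>c {..<d}\<close> is the multilinear part of
    \<open>c0\<close>.\<close>
  define c where "c T u = (if T \<subseteq> set u then c0 u else 0)" for T u
  have "word_eval y d d (c T) = \<zero>" if "finite T" "range y \<subseteq> carrier R" for T y
    using that
  proof (induction T arbitrary: y rule: finite_induct)
    case empty
    then show ?case using c0 by (simp add: c_def[abs_def])
  next
    case (insert p T)
    define y0 where "y0 = y(p := \<zero>)"
    define c' where "c' u = (if p \<in> set u then 0 else c T u)" for u
    have y0: "range y0 \<subseteq> carrier R" using insert.prems by (auto simp: y0_def)
    \<comment> \<open>\<open>c'\<close> collects the words without \<open>p\<close>. Their value is
      unchanged when \<open>y p\<close> is set to zero, and then it is all that is left of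
      \<open>c T\<close>, so the induction hypothesis at \<open>y0\<close> makes it vanish.\<close>
    have "c T = (\<lambda>u. c (insert p T) u + c' u)" by (auto simp: c_def c'_def)
    then have "word_eval y d d (c T) = word_eval y d d (c (insert p T)) \<oplus> word_eval y d d c'"
      using word_eval_add[OF insert.prems] by metis
    moreover have "word_eval y d d c' = word_eval y0 d d c'"
      by (rule word_eval_cong[OF insert.prems y0]) (auto simp: c'_def y0_def)
    moreover have "\<dots> = word_eval y0 d d (c T)"
      by (rule word_eval_zero_variable[OF y0]) (auto simp: c'_def y0_def)
    ultimately show ?case
      using insert.IH[OF y0] insert.IH[OF insert.prems] word_eval_closed[OF insert.prems] by simp
  qed
  then have "word_eval y d d (c {..<d}) = \<zero>" if "range y \<subseteq> carrier R" for y
    using that by simp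
  moreover have "map ((!) w) [0..<d] = w" by (simp add: d_def map_nth)
  then have "c {..<d} [0..<d] = 1" using w(2) by (simp add: c_def c0_def atLeast0LessThan)
  moreover have "c {..<d} u = 0" if "\<not> {..<d} \<subseteq> set u" for u using that by (simp add: c_def)
  ultimately show thesis using that by blast
qed

section \<open>From a multilinear identity to absorption\<close>

lemma additive_subgroup_finsum_closed:
  assumes "additive_subgroup H R" "finite A" "\<And>i. i \<in> A \<Longrightarrow> f i \<in> H"
  shows "finsum R f A \<in> H"
  using assms(2,3)
proof (induction A rule: finite_induct)
  case empty
  then show ?case using additive_subgroup.zero_closed[OF assms(1)] by simp
next
  case (insert i A)
  then have "f i \<in> H" "\<And>j. j \<in> A \<Longrightarrow> f j \<in> H" by auto
  then show ?case
    using insert additive_subgroup.a_subset[OF assms(1)] additive_subgroup.a_closed[OF assms(1)]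
    by (subst finsum_insert) auto
qed

text \<open>Write the multilinear identity as \<open>f\<^sub>0 = 0\<close>, where \<open>f\<^sub>k\<close> is \<open>y\<^sub>k f\<^sub>k\<^sub>+\<^sub>1\<close> plus words starting
  with some \<open>y\<^sub>j\<close>, \<open>j > k\<close>, and \<open>f\<^sub>d = 1\<close>. Substituting multiples of \<open>t\<^sub>j\<close> for \<open>y\<^sub>j\<close>, those further
  words land in \<open>T\<^sub>k\<close>, so \<open>g\<close> can be taken to be the first value of an \<open>f\<^sub>k\<^sub>+\<^sub>1\<close> outside \<open>K\<close>.\<close>

lemma pi_ring_absorbing:
  assumes "pi_ring R"
  shows "\<exists>d. absorbing R d"
proof -
  obtain d c where c1: "c [0..<d] = 1" and c0: "\<And>u. \<not> {..<d} \<subseteq> set u \<Longrightarrow> c u = 0"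
    and ev: "\<And>y. range y \<subseteq> carrier R \<Longrightarrow> word_eval y d d c = \<zero>"
    using pi_ring_multilinear_identity[OF assms] by metis
  \<comment> \<open>For words of length at most \<open>d\<close> this kills both the shorter ones
    and those with a repeated letter.\<close>
  have short: "c u = 0" if "card (set u) < d" for u
  proof (rule c0)
    show "\<not> {..<d} \<subseteq> set u" using that card_mono[of "set u" "{..<d}"] by auto
  qed
  have card_append: "card (set (v @ u)) \<le> length v + length u" for u v :: "nat list"
    by (metis card_length length_append)
  have main: "\<exists>k<d. \<exists>g\<in>carrier R - K. \<forall>r\<in>carrier R. t k \<otimes> r \<otimes> g \<in> T k"
    if t: "\<And>k. k < d \<Longrightarrow> t k \<in> carrier R" and T: "\<And>k. k < d \<Longrightarrow> right_ideal (T k) R"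
      and K: "\<And>k. k < d \<Longrightarrow> K \<subseteq> T k" and tT: "\<And>k j. k < j \<Longrightarrow> j < d \<Longrightarrow> t j \<in> T k"
      and "\<zero> \<in> K" "\<one> \<notin> K" for t T K
  proof (rule ccontr)
    assume "\<not> ?thesis"
    then have neg: "\<exists>r\<in>carrier R. t k \<otimes> r \<otimes> g \<notin> T k" if "k < d" "g \<in> carrier R" "g \<notin> K" for k g
      using that by blast
    define y where "y r j = (if j < d then t j \<otimes> r j else \<zero>)" for r j
    define f where "f k r = word_eval (y r) d (d - k) (\<lambda>u. c ([0..<k] @ u))" for k r
    have y: "range (y r) \<subseteq> carrier R" if "range r \<subseteq> carrier R" for r
      using that t by (auto simp: y_def)
    \<comment> \<open>If absorption fails, every \<open>f k r\<close> stays in \<open>K\<close>,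
      from \<open>f 0 r = \<zero>\<close> up to \<open>f d r = \<one>\<close>, which is outside. The
      claim covers all \<open>r\<close> at once because the inductive step changes the value at
      \<open>k\<close>.\<close>
    have "f k r \<in> K" if "k \<le> d" "range r \<subseteq> carrier R" for k r
      using that
    proof (induction k arbitrary: r)
      case 0
      then show ?case using ev[OF y] \<open>\<zero> \<in> K\<close> by (simp add: f_def)
    next
      case (Suc k)
      then have k: "k < d" and r: "range r \<subseteq> carrier R" by auto
      have fc: "f (Suc k) r \<in> carrier R" using word_eval_closed[OF y[OF r]] by (simp add: f_def)
      show ?case
      proof (rule ccontr)
        assume "f (Suc k) r \<notin> K"
        then obtain s where s: "s \<in> carrier R" "t k \<otimes> s \<otimes> f (Suc k) r \<notin> T k"
          using neg[OF k fc] by blast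
        define r' where "r' = r(k := s)"
        have r': "range r' \<subseteq> carrier R" using r s by (auto simp: r'_def)
        note y' = y[OF r']
        have Tk: "additive_subgroup (T k) R" "\<And>a b. a \<in> T k \<Longrightarrow> b \<in> carrier R \<Longrightarrow> a \<otimes> b \<in> T k"
          using T[OF k] by (auto simp: right_ideal_def)
        \<comment> \<open>Behind the prefix \<open>[0..<Suc k]\<close> the letter \<open>k\<close>
          would be a repetition, so the new value at \<open>k\<close> has no influence.\<close>
        have same: "f (Suc k) r' = f (Suc k) r"
          unfolding f_def
        proof (rule word_eval_cong[OF y' y[OF r]], intro conjI impI refl ballI)
          fix u j
          assume u: "length u \<le> d - Suc k" and nz: "c ([0..<Suc k] @ u) \<noteq> 0" and j: "j \<in> set u"
          have "j \<noteq> k"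
          proof
            assume "j = k"
            then have "set ([0..<Suc k] @ u) = set ([0..<k] @ u)" using j by auto
            then have "card (set ([0..<Suc k] @ u)) < d"
              using card_append[of "[0..<k]" u] u k by simp
            then show False using short nz by blast
          qed
          then show "y r' j = y r j" by (simp add: y_def r'_def)
        qed
        let ?h = "\<lambda>j. y r' j \<otimes> word_eval (y r') d (d - Suc k) (\<lambda>u. c ([0..<k] @ j # u))"
        have h: "?h j \<in> carrier R" for j
          using y' word_eval_closed[OF y'] by (auto simp: image_subset_iff)
        have hk: "?h k = t k \<otimes> s \<otimes> f (Suc k) r"
        proof -
          have "?h k = y r' k \<otimes> f (Suc k) r'" by (simp add: f_def)
          then show ?thesis using k same by (simp add: y_def r'_def)
        qed
        \<comment> \<open>A letter below \<open>k\<close> repeats one of the prefix; a letter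
          \<open>j\<close> above \<open>k\<close> brings in \<open>t j\<close>, which lies in the
          right ideal \<open>T k\<close>.\<close>
        have rest: "?h j \<in> T k" if j: "j < d" "j \<noteq> k" for j
        proof (cases "j < k")
          case True
          have "word_eval (y r') d (d - Suc k) (\<lambda>u. c ([0..<k] @ j # u)) = \<zero>"
          proof (rule word_eval_zero[OF y'])
            fix u :: "nat list" assume u: "length u \<le> d - Suc k"
            have "set ([0..<k] @ j # u) = set ([0..<k] @ u)" using True by auto
            then have "card (set ([0..<k] @ j # u)) < d"
              using card_append[of "[0..<k]" u] u k by simp
            then show "c ([0..<k] @ j # u) = 0" by (rule short)
          qed
          then show ?thesis
            using y' additive_subgroup.zero_closed[OF Tk(1)] by (auto simp: image_subset_iff)
        next
          case False
          then have "t j \<in> T k" using j tT by simp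
          then have "y r' j \<in> T k" using j Tk(2) r' by (simp add: y_def image_subset_iff)
          then show ?thesis using Tk(2) word_eval_closed[OF y'] by blast
        qed
        have "Suc (d - Suc k) = d - k" using k by simp
        then have "f k r' = word_eval (y r') d (Suc (d - Suc k)) (\<lambda>u. c ([0..<k] @ u))"
          by (simp add: f_def)
        also have "\<dots> = [c [0..<k]] \<cdot> \<one> \<oplus> (\<Oplus>j\<in>{..<d}. ?h j)" by simp
        also have "c [0..<k] = 0" using k by (intro short) simp
        also have "{..<d} = insert k ({..<d} - {k})" using k by auto
        also have "[(0::int)] \<cdot> \<one> \<oplus> (\<Oplus>j\<in>\<dots>. ?h j) = ?h k \<oplus> (\<Oplus>j\<in>{..<d} - {k}. ?h j)"
          using h by (subst finsum_insert) (auto simp: int_pow_zero intro!: finsum_closed)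
        finally have eq: "f k r' = ?h k \<oplus> (\<Oplus>j\<in>{..<d} - {k}. ?h j)" .
        have S: "(\<Oplus>j\<in>{..<d} - {k}. ?h j) \<in> T k"
          using rest by (intro additive_subgroup_finsum_closed[OF Tk(1)]) auto
        have "f k r' \<in> T k" using Suc.IH[OF _ r'] k K by auto
        moreover have "?h k = f k r' \<ominus> (\<Oplus>j\<in>{..<d} - {k}. ?h j)"
          using eq h by (simp add: minus_eq a_assoc r_neg finsum_closed)
        ultimately have "?h k \<in> T k"
          using S additive_subgroup.a_closed[OF Tk(1)] additive_subgroup.a_inv_closed[OF Tk(1)]
          by (simp add: minus_eq)
        then show False using hk s(2) by simp
      qed
    qed
    from this[of d "\<lambda>_. \<zero>"] have "[c [0..<d]] \<cdot> \<one> \<in> K" by (auto simp: f_def)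
    then show False using c1 \<open>\<one> \<notin> K\<close> by (simp add: add.int_pow_1)
  qed
  have "absorbing R d" by (rule absorbingI) (rule main)
  then show ?thesis ..
qed

end

section \<open>Completely integrally closed orders\<close>

locale cic_order = ring Q for Q (structure) +
  fixes S
  assumes subring: "subring S Q"
    and cic: "completely_integrally_closed Q S"
begin

lemma S_carrier [simp]: "x \<in> S \<Longrightarrow> x \<in> carrier Q"
  using subringE(1)[OF subring] by auto

lemma S_closed [simp]:
  "\<zero> \<in> S" "\<one> \<in> S" "x \<in> S \<Longrightarrow> \<ominus> x \<in> S"
  "x \<in> S \<Longrightarrow> y \<in> S \<Longrightarrow> x \<oplus> y \<in> S" "x \<in> S \<Longrightarrow> y \<in> S \<Longrightarrow> x \<otimes> y \<in> S"
  using subringE(2,3,5,6,7)[OF subring] by auto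

abbreviation S_ring where "S_ring \<equiv> Q\<lparr>carrier := S\<rparr>"

lemma right_ideal_iff:
  "right_ideal J S_ring \<longleftrightarrow> J \<subseteq> S \<and> \<zero> \<in> J \<and> (\<forall>x\<in>J. \<forall>y\<in>J. x \<oplus> y \<in> J) \<and>
     (\<forall>x\<in>J. \<forall>r\<in>S. x \<otimes> r \<in> J)" (is "?L \<longleftrightarrow> ?R")
proof
  assume ?L
  then show ?R
    using additive_subgroup.a_subset[of J S_ring] additive_subgroup.zero_closed[of J S_ring]
      additive_subgroup.a_closed[of J S_ring]
    by (auto simp: right_ideal_def)
next
  assume R: ?R
  interpret SR: ring S_ring by (rule subring_is_ring[OF subring])
  have neg: "\<ominus>\<^bsub>S_ring\<^esub> x \<in> J" if x: "x \<in> J" for x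
  proof -
    have xS: "x \<in> S" using x R by blast
    have "x \<otimes> (\<ominus> \<one>) \<in> J" using R x by simp
    then have "\<ominus> x \<in> J" using xS by (simp add: r_minus)
    moreover have "\<ominus>\<^bsub>S_ring\<^esub> x = \<ominus> x"
    proof (rule SR.minus_equality)
      show "\<ominus> x \<oplus>\<^bsub>S_ring\<^esub> x = \<zero>\<^bsub>S_ring\<^esub>" using xS by (simp add: l_neg)
    qed (use xS in auto)
    ultimately show ?thesis by simp
  qed
  have "subgroup J (add_monoid S_ring)"
    using R neg by (intro SR.add.subgroupI) (auto simp: a_inv_def)
  then show ?L using R by (simp add: right_ideal_def additive_subgroup_def)
qed

lemma ideal_iff:
  "ideal I S_ring \<longleftrightarrow> right_ideal I S_ring \<and> (\<forall>x\<in>I. \<forall>r\<in>S. r \<otimes> x \<in> I)"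
  using subring_is_ring[OF subring]
  by (auto simp: ideal_def ideal_axioms_def right_ideal_def)

lemma idealI:
  assumes "\<And>x. x \<in> I \<Longrightarrow> x \<in> S" "\<zero> \<in> I" "\<And>x y. x \<in> I \<Longrightarrow> y \<in> I \<Longrightarrow> x \<oplus> y \<in> I"
    "\<And>x r. x \<in> I \<Longrightarrow> r \<in> S \<Longrightarrow> x \<otimes> r \<in> I" "\<And>x r. x \<in> I \<Longrightarrow> r \<in> S \<Longrightarrow> r \<otimes> x \<in> I"
  shows "ideal I S_ring"
  unfolding ideal_iff right_ideal_iff using assms by (simp add: subset_iff)

lemma idealD:
  assumes "ideal I S_ring"
  shows "x \<in> I \<Longrightarrow> x \<in> S" "\<zero> \<in> I" "x \<in> I \<Longrightarrow> y \<in> I \<Longrightarrow> x \<oplus> y \<in> I"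
    "x \<in> I \<Longrightarrow> r \<in> S \<Longrightarrow> x \<otimes> r \<in> I" "x \<in> I \<Longrightarrow> r \<in> S \<Longrightarrow> r \<otimes> x \<in> I"
  using assms unfolding ideal_iff right_ideal_iff by blast+

lemma ideal_subset_carrier:
  assumes "ideal I S_ring" "x \<in> I"
  shows "x \<in> carrier Q"
  using idealD(1)[OF assms] by simp

lemma left_order_ideal:
  assumes "ideal I S_ring" "I \<noteq> {\<zero>}" "q \<in> carrier Q" "\<And>x. x \<in> I \<Longrightarrow> q \<otimes> x \<in> I"
  shows "q \<in> S"
  using assms cic unfolding completely_integrally_closed_def left_quot_def by blast

lemma right_order_ideal:
  assumes "ideal I S_ring" "I \<noteq> {\<zero>}" "q \<in> carrier Q" "\<And>x. x \<in> I \<Longrightarrow> x \<otimes> q \<in> I"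
  shows "q \<in> S"
  using assms cic unfolding completely_integrally_closed_def right_quot_def by blast

text \<open>If \<open>q I \<subseteq> S\<close>, then
  \<open>(I q) I = I (q I) \<subseteq> I\<close>, so \<open>I q\<close> lies in the left order of
  \<open>I\<close>, which is \<open>S\<close>; the converse is the mirror image. Hence one
  \<open>dual\<close> serves both sides.\<close>

lemma dual_left_iff_right:
  assumes I: "ideal I S_ring" "I \<noteq> {\<zero>}" and q: "q \<in> carrier Q"
  shows "(\<forall>x\<in>I. q \<otimes> x \<in> S) \<longleftrightarrow> (\<forall>x\<in>I. x \<otimes> q \<in> S)"
proof (intro iffI ballI)
  fix x assume h: "\<forall>x\<in>I. q \<otimes> x \<in> S" and x: "x \<in> I"
  have "x \<otimes> q \<otimes> y \<in> I" if "y \<in> I" for y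
    using idealD(4)[OF I(1) x, of "q \<otimes> y"] h that x q ideal_subset_carrier[OF I(1)]
    by (simp add: m_assoc)
  then show "x \<otimes> q \<in> S"
    using x q ideal_subset_carrier[OF I(1)] by (intro left_order_ideal[OF I]) auto
next
  fix x assume h: "\<forall>x\<in>I. x \<otimes> q \<in> S" and x: "x \<in> I"
  have "y \<otimes> (q \<otimes> x) \<in> I" if "y \<in> I" for y
    using idealD(5)[OF I(1) x, of "y \<otimes> q"] h that x q ideal_subset_carrier[OF I(1)]
    by (simp add: m_assoc)
  then show "q \<otimes> x \<in> S"
    using x q ideal_subset_carrier[OF I(1)] by (intro right_order_ideal[OF I]) auto
qed

section \<open>Duals and divisorial closures of two-sided ideals\<close>

abbreviation dual where "dual I \<equiv> left_quot Q S I"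

lemma dualD: "e \<in> dual I \<Longrightarrow> e \<in> carrier Q" "e \<in> dual I \<Longrightarrow> x \<in> I \<Longrightarrow> e \<otimes> x \<in> S"
  by (auto simp: left_quot_def)

lemma dualI: "e \<in> carrier Q \<Longrightarrow> (\<And>x. x \<in> I \<Longrightarrow> e \<otimes> x \<in> S) \<Longrightarrow> e \<in> dual I"
  by (auto simp: left_quot_def)

lemma right_quot_eq_dual:
  assumes "ideal I S_ring" "I \<noteq> {\<zero>}"
  shows "right_quot Q S I = dual I"
  using dual_left_iff_right[OF assms] by (auto simp: left_quot_def right_quot_def)

lemma dual_r:
  assumes "ideal I S_ring" "I \<noteq> {\<zero>}" "e \<in> dual I" "x \<in> I"
  shows "x \<otimes> e \<in> S"
  using assms right_quot_eq_dual[OF assms(1,2)] by (auto simp: right_quot_def)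

lemma dualI_r:
  assumes "ideal I S_ring" "I \<noteq> {\<zero>}" "e \<in> carrier Q" "\<And>x. x \<in> I \<Longrightarrow> x \<otimes> e \<in> S"
  shows "e \<in> dual I"
  using assms right_quot_eq_dual[OF assms(1,2)] by (auto simp: right_quot_def)

lemma dual_mult:
  assumes "ideal I S_ring" "e \<in> dual I" "s \<in> S"
  shows "s \<otimes> e \<in> dual I" "e \<otimes> s \<in> dual I"
proof -
  note c = dualD[OF assms(2)] ideal_subset_carrier[OF assms(1)]
  show "s \<otimes> e \<in> dual I" using c assms(3) by (intro dualI) (auto simp: m_assoc)
  show "e \<otimes> s \<in> dual I"
    using c assms(3) idealD(5)[OF assms(1) _ assms(3)] by (intro dualI) (auto simp: m_assoc)
qed

lemma one_dual: "ideal I S_ring \<Longrightarrow> \<one> \<in> dual I"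
  by (rule dualI) (auto dest: idealD(1))

definition cl where "cl I = left_quot Q S (dual I)"

lemma clD: "x \<in> cl I \<Longrightarrow> e \<in> dual I \<Longrightarrow> x \<otimes> e \<in> S" "x \<in> cl I \<Longrightarrow> x \<in> carrier Q"
  by (auto simp: cl_def left_quot_def)

lemma clI: "x \<in> carrier Q \<Longrightarrow> (\<And>e. e \<in> dual I \<Longrightarrow> x \<otimes> e \<in> S) \<Longrightarrow> x \<in> cl I"
  by (auto simp: cl_def left_quot_def)

lemma cl_subset_S:
  assumes "ideal I S_ring" "x \<in> cl I"
  shows "x \<in> S"
  using clD(1)[OF assms(2) one_dual[OF assms(1)]] clD(2)[OF assms(2)] by simp

lemma subset_cl:
  assumes "ideal I S_ring" "I \<noteq> {\<zero>}"
  shows "I \<subseteq> cl I"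
  using dual_r[OF assms] ideal_subset_carrier[OF assms(1)] by (auto intro!: clI)

lemma ideal_cl:
  assumes "ideal I S_ring" "I \<noteq> {\<zero>}"
  shows "ideal (cl I) S_ring" "cl I \<noteq> {\<zero>}"
proof -
  note c = clD(2) dualD(1) and S = cl_subset_S[OF assms(1)]
  have "r \<otimes> x \<in> cl I" if "x \<in> cl I" "r \<in> S" for x r
    using that c clD(1) by (intro clI) (auto simp: m_assoc)
  moreover have "x \<otimes> r \<in> cl I" if "x \<in> cl I" "r \<in> S" for x r
    using that c clD(1) dual_mult(1)[OF assms(1)] by (intro clI) (auto simp: m_assoc)
  moreover have "x \<oplus> y \<in> cl I" if "x \<in> cl I" "y \<in> cl I" for x y
    using that c clD(1) by (intro clI) (auto simp: l_distr)
  moreover have "\<zero> \<in> cl I" using dualD(1) by (intro clI) auto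
  ultimately show "ideal (cl I) S_ring" using S by (intro idealI)
  show "cl I \<noteq> {\<zero>}" using subset_cl[OF assms] assms(2) idealD(2)[OF assms(1)] by blast
qed

text \<open>Both inner quotients in \<open>divisorial_ideal\<close> are \<open>dual I\<close>, but
  this need not be an ideal of \<open>S\<close>, so left-right symmetry does not cover the outer
  right quotient \<open>L\<close>. As \<open>L\<close> is an ideal with
  \<open>dual I \<subseteq> dual L\<close>, symmetry for \<open>L\<close> yields
  \<open>L \<subseteq> cl I\<close>.\<close>

lemma divisorialI:
  assumes I: "ideal I S_ring" "I \<noteq> {\<zero>}" and "cl I \<subseteq> I"
  shows "divisorial_ideal Q S I"
proof -
  have cl: "cl I = I" using assms(3) subset_cl[OF I] by blast
  define L where "L = right_quot Q S (dual I)"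
  have LD: "e \<otimes> x \<in> S" "x \<in> carrier Q" if "x \<in> L" "e \<in> dual I" for x e
    using that by (auto simp: L_def right_quot_def)
  have LI: "x \<in> L" if "x \<in> carrier Q" "\<And>e. e \<in> dual I \<Longrightarrow> e \<otimes> x \<in> S" for x
    using that by (auto simp: L_def right_quot_def)
  have one: "\<one> \<in> dual I" by (rule one_dual[OF I(1)])
  have IL: "I \<subseteq> L" using dualD(2) ideal_subset_carrier[OF I(1)] by (auto intro!: LI)
  have LS: "x \<in> S" if "x \<in> L" for x using LD[OF that one] by simp
  have "ideal L S_ring"
  proof -
    have "r \<otimes> x \<in> L" if "x \<in> L" "r \<in> S" for x r
    proof (rule LI)
      fix e assume e: "e \<in> dual I"
      have "(e \<otimes> r) \<otimes> x \<in> S" using LD(1)[OF that(1) dual_mult(2)[OF I(1) e that(2)]] .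
      then show "e \<otimes> (r \<otimes> x) \<in> S" using that LS dualD(1)[OF e] by (simp add: m_assoc)
    qed (use that LS in auto)
    moreover have "x \<otimes> r \<in> L" if "x \<in> L" "r \<in> S" for x r
      using that LD(1) LS dualD(1) by (intro LI) (auto simp: m_assoc[symmetric])
    moreover have "x \<oplus> y \<in> L" if "x \<in> L" "y \<in> L" for x y
      using that LD(1) LS dualD(1) by (intro LI) (auto simp: r_distr)
    moreover have "\<zero> \<in> L" using IL idealD(2)[OF I(1)] by blast
    ultimately show ?thesis using LS by (intro idealI)
  qed
  moreover have "L \<noteq> {\<zero>}" using IL I(2) idealD(2)[OF I(1)] by blast
  moreover have "e \<in> dual L" if "e \<in> dual I" for e
    using that LD(1) dualD(1) by (intro dualI) auto
  ultimately have "L \<subseteq> cl I" using dual_r LS by (auto intro!: clI)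
  then have "L = I" using cl IL by blast
  then show ?thesis
    using I cl right_quot_eq_dual[OF I] by (simp add: divisorial_ideal_def L_def cl_def)
qed

lemma divisorialD:
  assumes "divisorial_ideal Q S I"
  shows "ideal I S_ring" "I \<noteq> {\<zero>}" "cl I = I"
  using assms right_quot_eq_dual[of I] by (auto simp: divisorial_ideal_def cl_def)

lemma divisorial_cl:
  assumes "ideal I S_ring" "I \<noteq> {\<zero>}"
  shows "divisorial_ideal Q S (cl I)"
proof (rule divisorialI[OF ideal_cl[OF assms]])
  have "dual I \<subseteq> dual (cl I)"
    using clD(1) dualD(1) by (auto intro!: dualI_r[OF ideal_cl[OF assms]])
  then show "cl (cl I) \<subseteq> cl I" using clD by (auto intro!: clI)
qed

text \<open>For \<open>x \<in> cl I\<close> the product \<open>x q e\<close> stays in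
  \<open>S\<close>, so \<open>q\<close> belongs to the right order of \<open>cl I\<close>. This
  strips factors from \<open>dual I\<close> when \<open>q \<in> S\<close> is tested.\<close>

lemma left_order_dual:
  assumes I: "ideal I S_ring" "I \<noteq> {\<zero>}" and q: "q \<in> carrier Q"
    and "\<And>e. e \<in> dual I \<Longrightarrow> q \<otimes> e \<in> dual I"
  shows "q \<in> S"
proof (rule right_order_ideal[OF ideal_cl[OF I] q])
  fix x assume x: "x \<in> cl I"
  show "x \<otimes> q \<in> cl I"
  proof (rule clI)
    fix e assume e: "e \<in> dual I"
    have "x \<otimes> (q \<otimes> e) \<in> S" using clD(1)[OF x assms(4)[OF e]] .
    then show "x \<otimes> q \<otimes> e \<in> S" using clD(2)[OF x] dualD(1)[OF e] q by (simp add: m_assoc)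
  qed (use clD(2)[OF x] q in auto)
qed

subsection \<open>Closed right ideals\<close>

text \<open>\<open>absorbed J x\<close> says that \<open>xN \<subseteq> J\<close> for a two-sided ideal \<open>N\<close> of \<open>S\<close> such that \<open>qN \<subseteq> S\<close>
  implies \<open>q \<in> S\<close>; the largest candidate is \<open>N = {s. xSs \<subseteq> J}\<close>.\<close>

definition absorbed where
  "absorbed J x \<longleftrightarrow> (\<forall>q\<in>carrier Q.
     (\<forall>s\<in>S. (\<forall>r\<in>S. x \<otimes> r \<otimes> s \<in> J) \<longrightarrow> q \<otimes> s \<in> S) \<longrightarrow> q \<in> S)"

definition closed_ideal where
  "closed_ideal J \<longleftrightarrow> right_ideal J S_ring \<and> (\<forall>x\<in>S. absorbed J x \<longrightarrow> x \<in> J)"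

lemma absorbedI:
  assumes "\<And>q. q \<in> carrier Q \<Longrightarrow>
    (\<And>s. s \<in> S \<Longrightarrow> (\<And>r. r \<in> S \<Longrightarrow> x \<otimes> r \<otimes> s \<in> J) \<Longrightarrow> q \<otimes> s \<in> S) \<Longrightarrow> q \<in> S"
  shows "absorbed J x"
  unfolding absorbed_def
proof (intro ballI impI)
  fix q assume q: "q \<in> carrier Q" "\<forall>s\<in>S. (\<forall>r\<in>S. x \<otimes> r \<otimes> s \<in> J) \<longrightarrow> q \<otimes> s \<in> S"
  show "q \<in> S" by (rule assms[OF q(1)]) (use q(2) in blast)
qed

lemma absorbedD:
  assumes "absorbed J x" "q \<in> carrier Q"
    "\<And>s. s \<in> S \<Longrightarrow> (\<And>r. r \<in> S \<Longrightarrow> x \<otimes> r \<otimes> s \<in> J) \<Longrightarrow> q \<otimes> s \<in> S"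
  shows "q \<in> S"
proof -
  have "\<forall>s\<in>S. (\<forall>r\<in>S. x \<otimes> r \<otimes> s \<in> J) \<longrightarrow> q \<otimes> s \<in> S" using assms(3) by blast
  then show ?thesis using assms(1,2) unfolding absorbed_def by blast
qed

lemma closed_idealI:
  assumes "\<And>x. x \<in> J \<Longrightarrow> x \<in> S" "\<zero> \<in> J" "\<And>x y. x \<in> J \<Longrightarrow> y \<in> J \<Longrightarrow> x \<oplus> y \<in> J"
    "\<And>x r. x \<in> J \<Longrightarrow> r \<in> S \<Longrightarrow> x \<otimes> r \<in> J" "\<And>x. x \<in> S \<Longrightarrow> absorbed J x \<Longrightarrow> x \<in> J"
  shows "closed_ideal J"
  unfolding closed_ideal_def right_ideal_iff
  by (intro conjI ballI subsetI impI; (rule assms; assumption))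

lemma closed_idealD:
  assumes "closed_ideal J"
  shows "x \<in> J \<Longrightarrow> x \<in> S" "\<zero> \<in> J" "x \<in> J \<Longrightarrow> y \<in> J \<Longrightarrow> x \<oplus> y \<in> J"
    "x \<in> J \<Longrightarrow> r \<in> S \<Longrightarrow> x \<otimes> r \<in> J" "x \<in> S \<Longrightarrow> absorbed J x \<Longrightarrow> x \<in> J"
proof -
  have J: "J \<subseteq> S" "\<zero> \<in> J" "\<forall>x\<in>J. \<forall>y\<in>J. x \<oplus> y \<in> J" "\<forall>x\<in>J. \<forall>r\<in>S. x \<otimes> r \<in> J"
    "\<forall>x\<in>S. absorbed J x \<longrightarrow> x \<in> J"
    using assms unfolding closed_ideal_def right_ideal_iff by simp_all
  show "x \<in> J \<Longrightarrow> x \<in> S" using J(1) by (rule subsetD)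
  show "\<zero> \<in> J" by (rule J(2))
  show "x \<in> J \<Longrightarrow> y \<in> J \<Longrightarrow> x \<oplus> y \<in> J" using J(3) by simp
  show "x \<in> J \<Longrightarrow> r \<in> S \<Longrightarrow> x \<otimes> r \<in> J" using J(4) by simp
  show "x \<in> S \<Longrightarrow> absorbed J x \<Longrightarrow> x \<in> J" using J(5) by simp
qed

lemma closed_ideal_minus:
  assumes "closed_ideal J" "x \<in> J" "y \<in> J"
  shows "x \<ominus> y \<in> J"
proof -
  have "y \<otimes> (\<ominus> \<one>) \<in> J" using closed_idealD(4)[OF assms(1,3)] by simp
  then have "\<ominus> y \<in> J" using closed_idealD(1)[OF assms(1,3)] by (simp add: r_minus)
  then show ?thesis using closed_idealD(3)[OF assms(1,2)] by (simp add: minus_eq)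
qed

text \<open>Membership of \<open>x\<close> in \<open>a S\<close> means
  \<open>inv a \<otimes> x \<in> S\<close>, which \<open>absorbed\<close> decides when its
  \<open>q\<close> is this very element.\<close>

lemma closed_principal:
  assumes a: "a \<in> S" "a \<in> Units Q"
  shows "closed_ideal {a \<otimes> s |s. s \<in> S}" (is "closed_ideal ?J")
proof -
  have J: "x \<in> ?J \<longleftrightarrow> x \<in> carrier Q \<and> inv a \<otimes> x \<in> S" for x
  proof
    assume "x \<in> ?J"
    then show "x \<in> carrier Q \<and> inv a \<otimes> x \<in> S" using a by (auto simp: m_assoc[symmetric])
  next
    assume x: "x \<in> carrier Q \<and> inv a \<otimes> x \<in> S"
    then have "x = a \<otimes> (inv a \<otimes> x)" using a by (simp add: m_assoc[symmetric])
    then show "x \<in> ?J" using x by blast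
  qed
  show ?thesis
  proof (rule closed_idealI)
    fix x assume x: "x \<in> S" "absorbed ?J x"
    have "inv a \<otimes> x \<in> S"
    proof (rule absorbedD[OF x(2)])
      fix s assume s: "s \<in> S" "\<And>r. r \<in> S \<Longrightarrow> x \<otimes> r \<otimes> s \<in> ?J"
      then show "inv a \<otimes> x \<otimes> s \<in> S" using s(2)[of \<one>] x(1) a unfolding J by (simp add: m_assoc)
    qed (use x(1) a in auto)
    then show "x \<in> ?J" using x(1) unfolding J by simp
  next
    fix x y assume "x \<in> ?J" "y \<in> ?J"
    then show "x \<oplus> y \<in> ?J" using a unfolding J by (simp add: r_distr)
  next
    fix x r assume "x \<in> ?J" "r \<in> S"
    then show "x \<otimes> r \<in> ?J" using a unfolding J by (simp add: m_assoc[symmetric])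
  next
    show "\<zero> \<in> ?J" using a unfolding J by simp
  qed (use a in auto)
qed

text \<open>The same elements \<open>s\<close> witness absorption of \<open>x\<close> by the
  residual and of \<open>z \<otimes> x\<close> by \<open>J\<close>.\<close>

lemma closed_residual:
  assumes J: "closed_ideal J" and z: "z \<in> S"
  shows "closed_ideal {s \<in> S. z \<otimes> s \<in> J}"
proof (rule closed_idealI)
  fix x assume x: "x \<in> S" "absorbed {s \<in> S. z \<otimes> s \<in> J} x"
  have "absorbed J (z \<otimes> x)"
  proof (rule absorbedI)
    fix q assume q: "q \<in> carrier Q"
      "\<And>s. s \<in> S \<Longrightarrow> (\<And>r. r \<in> S \<Longrightarrow> z \<otimes> x \<otimes> r \<otimes> s \<in> J) \<Longrightarrow> q \<otimes> s \<in> S"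
    show "q \<in> S" by (rule absorbedD[OF x(2) q(1)], rule q(2)) (use x z in \<open>auto simp: m_assoc\<close>)
  qed
  then show "x \<in> {s \<in> S. z \<otimes> s \<in> J}" using x z closed_idealD(5)[OF J] by simp
next
  fix x y assume "x \<in> {s \<in> S. z \<otimes> s \<in> J}" "y \<in> {s \<in> S. z \<otimes> s \<in> J}"
  then show "x \<oplus> y \<in> {s \<in> S. z \<otimes> s \<in> J}"
    using z closed_idealD(3)[OF J] by (simp add: r_distr)
next
  fix x r assume "x \<in> {s \<in> S. z \<otimes> s \<in> J}" "r \<in> S"
  then show "x \<otimes> r \<in> {s \<in> S. z \<otimes> s \<in> J}"
    using z closed_idealD(4)[OF J, of "z \<otimes> x" r] by (simp add: m_assoc)
qed (use z closed_idealD(2)[OF J] in auto)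

text \<open>If \<open>x\<close> is absorbed through an ideal \<open>N\<close>, then
  \<open>x y\<close> with \<open>y \<in> I\<close> is absorbed by \<open>J\<close> through the
  products \<open>e n z\<close> with \<open>e \<in> dual I\<close>, \<open>n \<in> N\<close>,
  \<open>z \<in> I\<close>: in \<open>x y r (e n z) = x (y r e) n z\<close> the factor
  \<open>y r e\<close> lies in \<open>S\<close>. To test \<open>q\<close>, the factors
  \<open>z\<close>, \<open>n\<close>, \<open>e\<close> are removed in turn by the definition of the
  dual, the absorption of \<open>x\<close>, and \<open>left_order_dual\<close>.\<close>

lemma closed_left_multipliers:
  assumes I: "ideal I S_ring" "I \<noteq> {\<zero>}" and J: "closed_ideal J"
  shows "closed_ideal {x \<in> S. \<forall>y\<in>I. x \<otimes> y \<in> J}" (is "closed_ideal ?D")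
proof (rule closed_idealI)
  note Ic = ideal_subset_carrier[OF I(1)] and IS = idealD(1)[OF I(1)]
  fix x assume x: "x \<in> S" "absorbed ?D x"
  have "x \<otimes> y \<in> J" if y: "y \<in> I" for y
  proof (rule closed_idealD(5)[OF J])
    show "x \<otimes> y \<in> S" using x IS[OF y] by simp
    show "absorbed J (x \<otimes> y)"
    proof (rule absorbedI)
      fix q assume q: "q \<in> carrier Q"
        "\<And>s. s \<in> S \<Longrightarrow> (\<And>r. r \<in> S \<Longrightarrow> x \<otimes> y \<otimes> r \<otimes> s \<in> J) \<Longrightarrow> q \<otimes> s \<in> S"
      show "q \<in> S"
      proof (rule left_order_dual[OF I q(1)])
        fix e assume e: "e \<in> dual I"
        note ec = dualD(1)[OF e]
        show "q \<otimes> e \<in> dual I"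
        proof (rule dualI_r[OF I])
          fix y' assume y': "y' \<in> I"
          show "y' \<otimes> (q \<otimes> e) \<in> S"
          proof (rule absorbedD[OF x(2)])
            fix n assume n: "n \<in> S" "\<And>r. r \<in> S \<Longrightarrow> x \<otimes> r \<otimes> n \<in> ?D"
            have "q \<otimes> e \<otimes> n \<in> dual I"
            proof (rule dualI)
              fix z assume z: "z \<in> I"
              have "q \<otimes> (e \<otimes> (n \<otimes> z)) \<in> S"
              proof (rule q(2))
                show "e \<otimes> (n \<otimes> z) \<in> S" using dualD(2)[OF e] idealD(5)[OF I(1) z n(1)] .
                fix r assume r: "r \<in> S"
                have "y \<otimes> r \<otimes> e \<in> S" using dual_r[OF I e] idealD(4)[OF I(1) y r] .
                then have "x \<otimes> (y \<otimes> r \<otimes> e) \<otimes> n \<otimes> z \<in> J" using n(2) z by blast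
                then show "x \<otimes> y \<otimes> r \<otimes> (e \<otimes> (n \<otimes> z)) \<in> J"
                  using x n r ec Ic[OF z] Ic[OF y] by (simp add: m_assoc)
              qed
              then show "q \<otimes> e \<otimes> n \<otimes> z \<in> S" using q(1) n ec Ic[OF z] by (simp add: m_assoc)
            qed (use q(1) n ec in auto)
            from dual_r[OF I this y'] show "y' \<otimes> (q \<otimes> e) \<otimes> n \<in> S"
              using q(1) n ec Ic[OF y'] by (simp add: m_assoc)
          qed (use q(1) ec Ic[OF y'] in auto)
        qed (use q(1) ec in auto)
      qed
    qed
  qed
  then show "x \<in> ?D" using x by simp
next
  fix x r assume "x \<in> ?D" "r \<in> S"
  then show "x \<otimes> r \<in> ?D"
    using idealD(5)[OF I(1)] ideal_subset_carrier[OF I(1)] by (auto simp: m_assoc)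
next
  fix x y assume "x \<in> ?D" "y \<in> ?D"
  then show "x \<oplus> y \<in> ?D"
    using closed_idealD(3)[OF J] ideal_subset_carrier[OF I(1)] by (auto simp: l_distr)
qed (use closed_idealD(2)[OF J] ideal_subset_carrier[OF I(1)] in auto)

section \<open>Closure of right ideals in the associated Gabriel topology\<close>

text \<open>An element \<open>x\<close> is in the closure of \<open>X\<close> if for all \<open>r\<close> the residual \<open>{s. xrs \<in> X}\<close> is contained in no
  proper closed right ideal. This is the closure for a Gabriel topology, so sums stay inside it.\<close>

definition closure where
  "closure X = {x \<in> S. \<forall>r\<in>S. \<forall>C. closed_ideal C \<longrightarrow>
     (\<forall>s\<in>S. x \<otimes> r \<otimes> s \<in> X \<longrightarrow> s \<in> C) \<longrightarrow> \<one> \<in> C}"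

lemma closureD:
  assumes "x \<in> closure X" "r \<in> S" "closed_ideal C" "\<And>s. s \<in> S \<Longrightarrow> x \<otimes> r \<otimes> s \<in> X \<Longrightarrow> s \<in> C"
  shows "\<one> \<in> C"
proof -
  have "\<forall>s\<in>S. x \<otimes> r \<otimes> s \<in> X \<longrightarrow> s \<in> C" using assms(4) by blast
  then show ?thesis using assms(1-3) unfolding closure_def by blast
qed

lemma closure_subset: "x \<in> closure X \<Longrightarrow> x \<in> S"
  by (simp add: closure_def)

lemma closureI:
  assumes "x \<in> S" "\<And>r C. r \<in> S \<Longrightarrow> closed_ideal C \<Longrightarrow>
    (\<And>s. s \<in> S \<Longrightarrow> x \<otimes> r \<otimes> s \<in> X \<Longrightarrow> s \<in> C) \<Longrightarrow> \<one> \<in> C"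
  shows "x \<in> closure X"
  unfolding closure_def
proof (intro CollectI conjI ballI allI impI)
  fix r C assume "r \<in> S" "closed_ideal C" "\<forall>s\<in>S. x \<otimes> r \<otimes> s \<in> X \<longrightarrow> s \<in> C"
  then show "\<one> \<in> C" using assms(2)[of r C] by blast
qed (rule assms(1))

lemma closure_mono:
  assumes "X \<subseteq> Y"
  shows "closure X \<subseteq> closure Y"
proof
  fix x assume x: "x \<in> closure X"
  show "x \<in> closure Y"
  proof (rule closureI)
    fix r C assume rC: "r \<in> S" "closed_ideal C" "\<And>s. s \<in> S \<Longrightarrow> x \<otimes> r \<otimes> s \<in> Y \<Longrightarrow> s \<in> C"
    show "\<one> \<in> C" by (rule closureD[OF x rC(1,2)], rule rC(3)) (use assms in auto)
  qed (rule closure_subset[OF x])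
qed

lemma subset_closure:
  assumes "right_ideal X S_ring"
  shows "X \<subseteq> closure X"
proof
  fix x assume x: "x \<in> X"
  show "x \<in> closure X"
  proof (rule closureI)
    fix r C assume r: "r \<in> S" and h: "\<And>s. s \<in> S \<Longrightarrow> x \<otimes> r \<otimes> s \<in> X \<Longrightarrow> s \<in> C"
    have "x \<otimes> r \<otimes> \<one> \<in> X" using x r assms by (simp add: right_ideal_iff)
    then show "\<one> \<in> C" using h by simp
  qed (use x assms in \<open>auto simp: right_ideal_iff\<close>)
qed

text \<open>Residuals of the closed test ideal \<open>C\<close> are again closed, so denominators
  can be composed. For a sum, a denominator \<open>s\<close> of \<open>a r\<close> is followed by a
  denominator \<open>t\<close> of \<open>b r s\<close>. For an absorbed \<open>x\<close>, every
  \<open>s\<close> with \<open>x S s \<subseteq> closure X\<close> satisfies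
  \<open>S s \<subseteq> C\<close> in the same way, so \<open>C\<close> absorbs
  \<open>\<one>\<close>.\<close>

lemma closed_closure:
  assumes X: "right_ideal X S_ring"
  shows "closed_ideal (closure X)"
proof (rule closed_idealI)
  show "\<zero> \<in> closure X" using subset_closure[OF X] X by (auto simp: right_ideal_iff)
next
  fix a b assume ab: "a \<in> closure X" "b \<in> closure X"
  note [simp] = closure_subset[OF ab(1)] closure_subset[OF ab(2)]
  show "a \<oplus> b \<in> closure X"
  proof (rule closureI)
    fix r C
    assume r: "r \<in> S" and C: "closed_ideal C"
      and h: "\<And>s. s \<in> S \<Longrightarrow> (a \<oplus> b) \<otimes> r \<otimes> s \<in> X \<Longrightarrow> s \<in> C"
    show "\<one> \<in> C"
    proof (rule closureD[OF ab(1) r C])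
      fix s assume s: "s \<in> S" "a \<otimes> r \<otimes> s \<in> X"
      have "\<one> \<in> {t \<in> S. s \<otimes> t \<in> C}"
      proof (rule closureD[OF ab(2) _ closed_residual[OF C s(1)]])
        show "r \<otimes> s \<in> S" using r s by simp
        fix t assume t: "t \<in> S" "b \<otimes> (r \<otimes> s) \<otimes> t \<in> X"
        have "a \<otimes> r \<otimes> s \<otimes> t \<in> X" using X s t by (auto simp: right_ideal_iff)
        then have "a \<otimes> r \<otimes> s \<otimes> t \<oplus> b \<otimes> (r \<otimes> s) \<otimes> t \<in> X"
          using X t by (auto simp: right_ideal_iff)
        then have "(a \<oplus> b) \<otimes> r \<otimes> (s \<otimes> t) \<in> X" using r s t by (simp add: l_distr m_assoc)
        then show "t \<in> {t \<in> S. s \<otimes> t \<in> C}" using h s t by simp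
      qed
      then show "s \<in> C" using s by simp
    qed
  qed simp
next
  fix x a assume x: "x \<in> closure X" and a: "a \<in> S"
  note [simp] = closure_subset[OF x] a
  show "x \<otimes> a \<in> closure X"
  proof (rule closureI)
    fix r C assume rC: "r \<in> S" "closed_ideal C" "\<And>s. s \<in> S \<Longrightarrow> x \<otimes> a \<otimes> r \<otimes> s \<in> X \<Longrightarrow> s \<in> C"
    show "\<one> \<in> C"
      by (rule closureD[OF x _ rC(2), of "a \<otimes> r"]) (use rC in \<open>auto simp: m_assoc\<close>)
  qed simp
next
  fix x assume x: "x \<in> S" "absorbed (closure X) x"
  show "x \<in> closure X"
  proof (rule closureI[OF x(1)])
    fix r C
    assume r: "r \<in> S" and C: "closed_ideal C"
      and h: "\<And>s. s \<in> S \<Longrightarrow> x \<otimes> r \<otimes> s \<in> X \<Longrightarrow> s \<in> C"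
    show "\<one> \<in> C"
    proof (rule closed_idealD(5)[OF C], simp, rule absorbedI)
      fix q assume q: "q \<in> carrier Q"
        "\<And>s. s \<in> S \<Longrightarrow> (\<And>r. r \<in> S \<Longrightarrow> \<one> \<otimes> r \<otimes> s \<in> C) \<Longrightarrow> q \<otimes> s \<in> S"
      show "q \<in> S"
      proof (rule absorbedD[OF x(2) q(1)], rule q(2))
        fix s r' assume s: "s \<in> S" "\<And>r. r \<in> S \<Longrightarrow> x \<otimes> r \<otimes> s \<in> closure X" and r': "r' \<in> S"
        have "\<one> \<in> {t \<in> S. (r' \<otimes> s) \<otimes> t \<in> C}"
        proof (rule closureD[OF s(2) _ closed_residual[OF C]])
          fix t assume t: "t \<in> S" "x \<otimes> (r \<otimes> r') \<otimes> s \<otimes> \<one> \<otimes> t \<in> X"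
          then show "t \<in> {t \<in> S. r' \<otimes> s \<otimes> t \<in> C}"
            using h[of "r' \<otimes> s \<otimes> t"] r r' s x by (simp add: m_assoc)
        qed (use r r' s in auto)
        then show "\<one> \<otimes> r' \<otimes> s \<in> C" using r' s by simp
      qed
    qed
  qed
qed (rule closure_subset)

end

section \<open>Chains of closed right ideals\<close>

lemma acc_induct [consumes 2, case_names step]:
  assumes "acc F" "I \<in> F" and step: "\<And>I. I \<in> F \<Longrightarrow> (\<And>J. J \<in> F \<Longrightarrow> I \<subset> J \<Longrightarrow> P J) \<Longrightarrow> P I"
  shows "P I"
proof -
  let ?r = "{(J, I). J \<in> F \<and> I \<in> F \<and> I \<subset> J}"
  have "wf ?r"
    unfolding wf_iff_no_infinite_down_chain
  proof
    assume "\<exists>f. \<forall>i. (f (Suc i), f i) \<in> ?r"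
    then obtain f where f: "\<And>i. f (Suc i) \<in> F \<and> f i \<in> F \<and> f i \<subset> f (Suc i)" by blast
    then have "\<forall>n. f n \<in> F \<and> f n \<subseteq> f (Suc n)" by blast
    then obtain n where n: "\<forall>m\<ge>n. f m = f n" using assms(1) unfolding acc_def by blast
    then have "f (Suc n) = f n" using le_SucI[OF order_refl] by blast
    then show False using f[of n] by simp
  qed
  then show ?thesis
    using assms(2)
  proof (induction I rule: wf_induct_rule)
    case (less I)
    show ?case
    proof (rule step[OF less.prems])
      show "P J" if "J \<in> F" "I \<subset> J" for J using that less by blast
    qed
  qed
qed

section \<open>Absorption together with the chain condition on divisorial ideals\<close>

locale pi_krull_order = cic_order +
  fixes d :: nat
  assumes one_neq_zero: "\<one> \<noteq> \<zero>"
    and acc_divisorial: "acc {I. divisorial_ideal Q S I}"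
    and absorbing: "absorbing (Q\<lparr>carrier := S\<rparr>) d"
begin

lemmas absorption = absorbingD[OF absorbing, simplified]

text \<open>Absorption is applied to the powers of \<open>a\<close>, with
  \<open>T k = a^(k+1) S\<close>. Cancelling \<open>a^k\<close> from
  \<open>a^k S g \<subseteq> a^(k+1) S\<close> leaves \<open>S g \<subseteq> a S\<close> with
  \<open>g\<close> nonzero; \<open>N\<close> is the largest two-sided ideal inside
  \<open>a S\<close>.\<close>

lemma principal_contains_ideal:
  assumes a: "a \<in> S" "a \<in> Units Q"
  obtains N where "ideal N S_ring" "N \<noteq> {\<zero>}" "N \<subseteq> {a \<otimes> s |s. s \<in> S}"
proof -
  define T where "T k = {a [^] Suc k \<otimes> s |s. s \<in> S}" for k :: nat
  have pow: "a [^] k \<in> S" "a [^] k \<in> Units Q" for k :: nat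
  proof -
    show "a [^] k \<in> S" by (induction k) (use a in auto)
    show "a [^] k \<in> Units Q" using a by (rule_tac Units_pow_closed)
  qed
  have "\<exists>k<d. \<exists>g\<in>S - {\<zero>}. \<forall>r\<in>S. a [^] k \<otimes> r \<otimes> g \<in> T k"
  proof (rule absorption)
    fix k :: nat
    show "a [^] k \<in> S" by (rule pow)
    show ri: "right_ideal (T k) S_ring"
      using closed_principal[OF pow, of "Suc k"] unfolding T_def closed_ideal_def by (rule conjunct1)
    show "{\<zero>} \<subseteq> T k" using ri unfolding right_ideal_iff by simp
    fix j assume "k < j" "j < d"
    then have "a [^] j = a [^] Suc k \<otimes> a [^] (j - Suc k)"
      using nat_pow_mult[of a "Suc k" "j - Suc k"] a by (simp del: nat_pow_Suc)
    then show "a [^] j \<in> T k" using pow(1)[of "j - Suc k"] unfolding T_def by blast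
  qed (use one_neq_zero in simp_all)
  then obtain k g where g: "g \<in> S" "g \<noteq> \<zero>" "\<And>r. r \<in> S \<Longrightarrow> a [^] k \<otimes> r \<otimes> g \<in> T k" by blast
  let ?J = "{a \<otimes> s |s. s \<in> S}"
  note J = closed_idealD[OF closed_principal[OF a]]
  have rg: "r \<otimes> g \<in> ?J" if r: "r \<in> S" for r
  proof -
    obtain s where s: "s \<in> S" "a [^] k \<otimes> r \<otimes> g = a [^] Suc k \<otimes> s" using g(3)[OF r] by (auto simp: T_def)
    then have "a [^] k \<otimes> (r \<otimes> g) = a [^] k \<otimes> (a \<otimes> s)" using r g(1) a pow by (simp add: m_assoc)
    then have "r \<otimes> g = a \<otimes> s" using Units_l_cancel[OF pow(2)] r g(1) a s by simp
    then show ?thesis using s by blast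
  qed
  define N where "N = {x \<in> S. \<forall>r\<in>S. r \<otimes> x \<in> ?J}"
  have ND: "x \<in> S" "r \<in> S \<Longrightarrow> r \<otimes> x \<in> ?J" if "x \<in> N" for x r using that by (auto simp: N_def)
  have NI: "x \<in> N" if "x \<in> S" "\<And>r. r \<in> S \<Longrightarrow> r \<otimes> x \<in> ?J" for x using that by (auto simp: N_def)
  have "ideal N S_ring"
  proof (rule idealI)
    show "\<zero> \<in> N" using J(2) by (intro NI) simp_all
    show "x \<oplus> y \<in> N" if "x \<in> N" "y \<in> N" for x y
    proof (rule NI)
      fix r assume r: "r \<in> S"
      show "r \<otimes> (x \<oplus> y) \<in> ?J"
        using J(3)[OF ND(2)[OF that(1) r] ND(2)[OF that(2) r]] r ND(1) that by (simp add: r_distr)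
    qed (use that ND(1) in simp)
    show "x \<otimes> s \<in> N" if "x \<in> N" "s \<in> S" for x s
    proof (rule NI)
      fix r assume r: "r \<in> S"
      show "r \<otimes> (x \<otimes> s) \<in> ?J"
        using J(4)[OF ND(2)[OF that(1) r] that(2)] r ND(1) that by (simp add: m_assoc)
    qed (use that ND(1) in simp)
    show "s \<otimes> x \<in> N" if "x \<in> N" "s \<in> S" for x s
    proof (rule NI)
      fix r assume r: "r \<in> S"
      show "r \<otimes> (s \<otimes> x) \<in> ?J"
        using ND(2)[OF that(1), of "r \<otimes> s"] r ND(1) that by (simp add: m_assoc)
    qed (use that ND(1) in simp)
  qed (rule ND(1))
  moreover have "g \<in> N" using g(1) rg by (rule NI)
  then have "N \<noteq> {\<zero>}" using g(2) by blast
  moreover have "N \<subseteq> ?J"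
  proof
    fix x assume "x \<in> N"
    then show "x \<in> ?J" using ND(2)[of x \<one>] ND(1)[of x] by simp
  qed
  ultimately show thesis by (rule that)
qed

text \<open>Sequences may repeat and only proper steps are counted, so a chain derived from another
  one may stall without being reindexed.\<close>

definition chain_bound where
  "chain_bound I n \<longleftrightarrow> (\<forall>J m. (\<forall>i. closed_ideal (J i) \<and> J (Suc i) \<subseteq> J i \<and> I \<subseteq> J i) \<longrightarrow>
     card {i. i < m \<and> J (Suc i) \<noteq> J i} \<le> n)"

lemma chain_boundI:
  assumes "\<And>J m. (\<And>i. closed_ideal (J i)) \<Longrightarrow> (\<And>i. J (Suc i) \<subseteq> J i) \<Longrightarrow> (\<And>i. I \<subseteq> J i) \<Longrightarrow>
    card {i. i < m \<and> J (Suc i) \<noteq> J i} \<le> n"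
  shows "chain_bound I n"
  unfolding chain_bound_def
proof (intro allI impI)
  fix J m assume "\<forall>i. closed_ideal (J i) \<and> J (Suc i) \<subseteq> J i \<and> I \<subseteq> J i"
  then show "card {i. i < m \<and> J (Suc i) \<noteq> J i} \<le> n" by (intro assms) blast+
qed

lemma chain_boundD:
  assumes "chain_bound I n" "\<And>i. closed_ideal (J i)" "\<And>i. J (Suc i) \<subseteq> J i" "\<And>i. I \<subseteq> J i"
  shows "card {i. i < m \<and> J (Suc i) \<noteq> J i} \<le> n"
  using assms unfolding chain_bound_def by blast

text \<open>Choose \<open>t k\<close> in the upper but not in the lower member of the k-th proper
  step. Absorption yields a \<open>k\<close> for which the ideal \<open>N\<close> of all
  \<open>x\<close> with \<open>t k S x\<close> in the lower member contains some \<open>g\<close>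
  outside \<open>P\<close>. By maximality \<open>cl N = S\<close>, so the closed lower member
  absorbs, and therefore contains, \<open>t k\<close>.\<close>

lemma chain_bound_maximal:
  assumes P: "divisorial_ideal Q S P" "P \<noteq> S"
    and max: "\<And>I. divisorial_ideal Q S I \<Longrightarrow> P \<subset> I \<Longrightarrow> I = S"
  shows "chain_bound P d"
proof (rule chain_boundI)
  fix J m
  assume J: "\<And>i. closed_ideal (J i)" "\<And>i. J (Suc i) \<subseteq> J i" "\<And>i. P \<subseteq> J i"
  note Pi = divisorialD[OF P(1)]
  define M where "M = {i. i < m \<and> J (Suc i) \<noteq> J i}"
  have "card M \<le> d"
  proof (rule ccontr)
    assume large: "\<not> card M \<le> d"
    \<comment> \<open>\<open>h\<close> lists the proper steps in increasing order, which gives the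
      triangularity required by \<open>absorbing\<close>.\<close>
    obtain h where h: "bij_betw h {..<card M} M" "strict_mono_on {..<card M} h"
      using ex_bij_betw_strict_mono_card[of M] by (auto simp: M_def)
    have hM: "h k \<in> M" if "k < d" for k using bij_betwE[OF h(1)] that large by simp
    have "\<exists>x. x \<in> J (h k) \<and> x \<notin> J (Suc (h k))" if "k < d" for k
      using hM[OF that] J(2)[of "h k"] by (auto simp: M_def)
    then obtain t where t: "\<And>k. k < d \<Longrightarrow> t k \<in> J (h k)" "\<And>k. k < d \<Longrightarrow> t k \<notin> J (Suc (h k))"
      by metis
    have "\<exists>k<d. \<exists>g\<in>S - P. \<forall>r\<in>S. t k \<otimes> r \<otimes> g \<in> J (Suc (h k))"
    proof (rule absorption)
      fix k assume k: "k < d"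
      show "t k \<in> S" using closed_idealD(1)[OF J(1) t(1)[OF k]] .
      show "right_ideal (J (Suc (h k))) S_ring" using J(1)[of "Suc (h k)"] unfolding closed_ideal_def by blast
      show "P \<subseteq> J (Suc (h k))" by (rule J(3))
    next
      fix k j assume kj: "k < j" "j < d"
      then have "h k < h j" using strict_mono_onD[OF h(2)] large by simp
      then have "J (h j) \<subseteq> J (Suc (h k))" by (intro lift_Suc_antimono_le[of J, OF J(2)]) simp
      then show "t j \<in> J (Suc (h k))" using t(1)[OF kj(2)] by blast
    next
      show "\<zero> \<in> P" by (rule idealD(2)[OF Pi(1)])
      show "\<one> \<notin> P"
      proof
        assume "\<one> \<in> P"
        then have "s \<in> P" if "s \<in> S" for s using idealD(4)[OF Pi(1) \<open>\<one> \<in> P\<close> that] that by simp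
        then show False using P(2) idealD(1)[OF Pi(1)] by blast
      qed
    qed
    then obtain k g where k: "k < d" and g: "g \<in> S" "g \<notin> P"
      and tg: "\<And>r. r \<in> S \<Longrightarrow> t k \<otimes> r \<otimes> g \<in> J (Suc (h k))" by blast
    let ?T = "J (Suc (h k))"
    have tS: "t k \<in> S" using closed_idealD(1)[OF J(1) t(1)[OF k]] .
    note T = closed_idealD[OF J(1)[of "Suc (h k)"]]
    define N where "N = {x \<in> S. \<forall>r\<in>S. t k \<otimes> r \<otimes> x \<in> ?T}"
    have ND: "x \<in> S" "r \<in> S \<Longrightarrow> t k \<otimes> r \<otimes> x \<in> ?T" if "x \<in> N" for x r using that by (auto simp: N_def)
    have NI: "x \<in> N" if "x \<in> S" "\<And>r. r \<in> S \<Longrightarrow> t k \<otimes> r \<otimes> x \<in> ?T" for x using that by (auto simp: N_def)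
    have N: "ideal N S_ring"
    proof (rule idealI)
      show "\<zero> \<in> N" using T(2) tS by (intro NI) simp_all
      show "x \<oplus> y \<in> N" if "x \<in> N" "y \<in> N" for x y
      proof (rule NI)
        fix r assume r: "r \<in> S"
        show "t k \<otimes> r \<otimes> (x \<oplus> y) \<in> ?T"
          using T(3)[OF ND(2)[OF that(1) r] ND(2)[OF that(2) r]] r tS ND(1) that by (simp add: r_distr)
      qed (use that ND(1) in simp)
      show "x \<otimes> s \<in> N" if "x \<in> N" "s \<in> S" for x s
      proof (rule NI)
        fix r assume r: "r \<in> S"
        show "t k \<otimes> r \<otimes> (x \<otimes> s) \<in> ?T"
          using T(4)[OF ND(2)[OF that(1) r] that(2)] r tS ND(1) that by (simp add: m_assoc)
      qed (use that ND(1) in simp)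
      show "s \<otimes> x \<in> N" if "x \<in> N" "s \<in> S" for x s
      proof (rule NI)
        fix r assume r: "r \<in> S"
        show "t k \<otimes> r \<otimes> (s \<otimes> x) \<in> ?T"
          using ND(2)[OF that(1), of "r \<otimes> s"] r tS ND(1) that by (simp add: m_assoc)
      qed (use that ND(1) in simp)
    qed (rule ND(1))
    have PN: "P \<subseteq> N"
    proof
      fix x assume x: "x \<in> P"
      show "x \<in> N"
      proof (rule NI)
        fix r assume r: "r \<in> S"
        have "t k \<otimes> r \<otimes> x \<in> P" using idealD(5)[OF Pi(1) x, of "t k \<otimes> r"] r tS by simp
        then show "t k \<otimes> r \<otimes> x \<in> ?T" using J(3) by blast
      qed (rule idealD(1)[OF Pi(1) x])
    qed
    have gN: "g \<in> N" using g(1) tg by (rule NI)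
    have N0: "N \<noteq> {\<zero>}" using gN g(2) idealD(2)[OF Pi(1)] by blast
    have "P \<subset> cl N" using PN gN g(2) subset_cl[OF N N0] by blast
    then have "cl N = S" by (rule max[OF divisorial_cl[OF N N0]])
    then have one: "\<one> \<in> cl N" by simp
    have "absorbed ?T (t k)"
    proof (rule absorbedI)
      fix q assume q: "q \<in> carrier Q"
        "\<And>s. s \<in> S \<Longrightarrow> (\<And>r. r \<in> S \<Longrightarrow> t k \<otimes> r \<otimes> s \<in> ?T) \<Longrightarrow> q \<otimes> s \<in> S"
      have "q \<in> dual N"
      proof (rule dualI[OF q(1)])
        fix x assume "x \<in> N"
        from q(2)[OF ND[OF this]] show "q \<otimes> x \<in> S" .
      qed
      from clD(1)[OF one this] show "q \<in> S" using q(1) by simp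
    qed
    then have "t k \<in> ?T" by (rule T(5)[OF tS])
    then show False using t(2)[OF k] by simp
  qed
  then show "card {i. i < m \<and> J (Suc i) \<noteq> J i} \<le> d" by (simp add: M_def)
qed

text \<open>Let C be the colon ideal. If \<open>x \<in> cl C\<close> and
  \<open>e \<in> dual I\<close>, then \<open>e P \<subseteq> dual C\<close>, so
  \<open>x e P \<subseteq> S\<close>; symmetry of the dual turns this into
  \<open>P x e \<subseteq> S\<close>, whence \<open>P x \<subseteq> cl I = I\<close>. For
  strictness, \<open>dual P\<close> maps \<open>I\<close> into C. If C were \<open>I\<close>, then
  \<open>dual P\<close> would lie in the left order \<open>S\<close> of \<open>I\<close>, forcing
  \<open>P = cl P = S\<close>.\<close>

lemma divisorial_colon:
  assumes P: "divisorial_ideal Q S P" "P \<noteq> S" and I: "divisorial_ideal Q S I" and sub: "I \<subseteq> P"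
  shows "divisorial_ideal Q S {x \<in> S. \<forall>p\<in>P. p \<otimes> x \<in> I}" (is "divisorial_ideal Q S ?C")
    and "I \<subset> {x \<in> S. \<forall>p\<in>P. p \<otimes> x \<in> I}"
proof -
  note Pi = divisorialD[OF P(1)] and Ii = divisorialD[OF I]
  note Pc = ideal_subset_carrier[OF Pi(1)] and Ic = ideal_subset_carrier[OF Ii(1)]
  have CI: "x \<in> ?C" if "x \<in> S" "\<And>p. p \<in> P \<Longrightarrow> p \<otimes> x \<in> I" for x using that by simp
  have CD: "x \<in> S" "p \<in> P \<Longrightarrow> p \<otimes> x \<in> I" if "x \<in> ?C" for x p using that by auto
  have IC: "I \<subseteq> ?C"
  proof
    fix x assume x: "x \<in> I"
    show "x \<in> ?C"
    proof (rule CI)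
      fix p assume "p \<in> P"
      then show "p \<otimes> x \<in> I" using idealD(5)[OF Ii(1) x] idealD(1)[OF Pi(1)] by simp
    qed (rule idealD(1)[OF Ii(1) x])
  qed
  have C: "ideal ?C S_ring"
  proof (rule idealI)
    show "\<zero> \<in> ?C" using IC idealD(2)[OF Ii(1)] by blast
    show "x \<oplus> y \<in> ?C" if "x \<in> ?C" "y \<in> ?C" for x y
    proof (rule CI)
      fix p assume p: "p \<in> P"
      show "p \<otimes> (x \<oplus> y) \<in> I"
        using idealD(3)[OF Ii(1) CD(2)[OF that(1) p] CD(2)[OF that(2) p]] Pc[OF p]
          CD(1)[OF that(1)] CD(1)[OF that(2)]
        by (simp add: r_distr)
    qed (use CD(1)[OF that(1)] CD(1)[OF that(2)] in simp)
    show "x \<otimes> s \<in> ?C" if "x \<in> ?C" "s \<in> S" for x s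
    proof (rule CI)
      fix p assume p: "p \<in> P"
      show "p \<otimes> (x \<otimes> s) \<in> I"
        using idealD(4)[OF Ii(1) CD(2)[OF that(1) p] that(2)] Pc[OF p]
          CD(1)[OF that(1)] that(2) by (simp add: m_assoc)
    qed (use CD(1)[OF that(1)] that(2) in simp)
    show "s \<otimes> x \<in> ?C" if "x \<in> ?C" "s \<in> S" for x s
    proof (rule CI)
      fix p assume p: "p \<in> P"
      show "p \<otimes> (s \<otimes> x) \<in> I"
        using CD(2)[OF that(1) idealD(4)[OF Pi(1) p that(2)]] Pc[OF p]
          CD(1)[OF that(1)] that(2) by (simp add: m_assoc)
    qed (use CD(1)[OF that(1)] that(2) in simp)
  qed (rule CD(1))
  have C0: "?C \<noteq> {\<zero>}" using IC Ii(2) idealD(2)[OF Ii(1)] by blast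
  show "divisorial_ideal Q S ?C"
  proof (rule divisorialI[OF C C0], rule subsetI)
    fix x assume x: "x \<in> cl ?C"
    note xS = cl_subset_S[OF C x]
    show "x \<in> ?C"
    proof (rule CI[OF xS])
      fix p assume p: "p \<in> P"
      have "p \<otimes> x \<in> cl I"
      proof (rule clI)
        fix e assume e: "e \<in> dual I"
        note ec = dualD(1)[OF e]
        have in_S: "(x \<otimes> e) \<otimes> p \<in> S" if "p \<in> P" for p
        proof -
          have "e \<otimes> p \<in> dual ?C"
          proof (rule dualI)
            fix y assume y: "y \<in> ?C"
            show "e \<otimes> p \<otimes> y \<in> S"
              using dualD(2)[OF e CD(2)[OF y that]] ec Pc[OF that] CD(1)[OF y] by (simp add: m_assoc)
          qed (use ec Pc[OF that] in simp)
          from clD(1)[OF x this] show ?thesis using ec Pc[OF that] xS by (simp add: m_assoc)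
        qed
        have "x \<otimes> e \<in> dual P" using in_S xS ec by (intro dualI) simp_all
        from dual_r[OF Pi(1,2) this p] show "p \<otimes> x \<otimes> e \<in> S" using xS ec Pc[OF p] by (simp add: m_assoc)
      qed (use xS Pc[OF p] in simp)
      then show "p \<otimes> x \<in> I" using Ii(3) by simp
    qed
  qed
  have "I \<noteq> ?C"
  proof
    assume eq: "I = ?C"
    have "e \<in> S" if e: "e \<in> dual P" for e
    proof (rule left_order_ideal[OF Ii(1,2) dualD(1)[OF e]])
      fix x assume x: "x \<in> I"
      have "e \<otimes> x \<in> ?C"
      proof (rule CI)
        show "e \<otimes> x \<in> S" using dualD(2)[OF e] x sub by blast
        fix p assume p: "p \<in> P"
        have "p \<otimes> e \<in> S" by (rule dual_r[OF Pi(1,2) e p])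
        from idealD(5)[OF Ii(1) x this] show "p \<otimes> (e \<otimes> x) \<in> I"
          using dualD(1)[OF e] Pc[OF p] Ic[OF x] by (simp add: m_assoc)
      qed
      then show "e \<otimes> x \<in> I" using eq by simp
    qed
    then have "S \<subseteq> cl P" by (auto intro!: clI)
    then show False using Pi(3) P(2) idealD(1)[OF Pi(1)] by blast
  qed
  then show "I \<subset> ?C" using IC by blast
qed

text \<open>The analogue of the modular law: a step of the chain survives either modulo \<open>C\<close> or, after
  translation by the dual of \<open>C\<close>, inside \<open>C\<close>.\<close>

lemma closed_chain_step:
  assumes C: "ideal C S_ring" "C \<noteq> {\<zero>}"
    and J: "closed_ideal J" "closed_ideal J'" "J' \<subseteq> J"
    and A: "J \<subseteq> closure {j \<oplus> y |j y. j \<in> J' \<and> y \<in> C}"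
    and D: "{x \<in> S. \<forall>y\<in>C. x \<otimes> y \<in> J} \<subseteq> {x \<in> S. \<forall>y\<in>C. x \<otimes> y \<in> J'}"
  shows "J = J'"
proof -
  note Cc = ideal_subset_carrier[OF C(1)]
  \<comment> \<open>For \<open>e \<in> dual C\<close> the element \<open>y r e\<close> lies in
    \<open>S\<close> and carries \<open>C\<close> into \<open>J\<close>, hence by \<open>D\<close>
    also into \<open>J'\<close>. So \<open>y\<close> is absorbed by \<open>J'\<close> through the
    products \<open>e z\<close> with \<open>z \<in> C\<close>.\<close>
  have inter: "y \<in> J'" if y: "y \<in> J" "y \<in> C" for y
  proof (rule closed_idealD(5)[OF J(2) idealD(1)[OF C(1) y(2)]], rule absorbedI)
    fix q assume q: "q \<in> carrier Q"
      "\<And>s. s \<in> S \<Longrightarrow> (\<And>r. r \<in> S \<Longrightarrow> y \<otimes> r \<otimes> s \<in> J') \<Longrightarrow> q \<otimes> s \<in> S"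
    show "q \<in> S"
    proof (rule left_order_dual[OF C q(1)], rule dualI)
      fix e assume e: "e \<in> dual C"
      note ec = dualD(1)[OF e]
      show "q \<otimes> e \<in> carrier Q" using q(1) ec by simp
      fix z assume z: "z \<in> C"
      have "q \<otimes> (e \<otimes> z) \<in> S"
      proof (rule q(2))
        show "e \<otimes> z \<in> S" by (rule dualD(2)[OF e z])
        fix r assume r: "r \<in> S"
        have yr: "y \<otimes> r \<in> J" "y \<otimes> r \<in> C"
          using closed_idealD(4)[OF J(1) y(1) r] idealD(4)[OF C(1) y(2) r] by simp_all
        have "y \<otimes> r \<otimes> e \<in> {x \<in> S. \<forall>y\<in>C. x \<otimes> y \<in> J}"
        proof (intro CollectI conjI ballI)
          show "y \<otimes> r \<otimes> e \<in> S" by (rule dual_r[OF C e yr(2)])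
          fix w assume w: "w \<in> C"
          show "y \<otimes> r \<otimes> e \<otimes> w \<in> J"
            using closed_idealD(4)[OF J(1) yr(1) dualD(2)[OF e w]] Cc[OF y(2)] r ec Cc[OF w]
            by (simp add: m_assoc)
        qed
        then have "y \<otimes> r \<otimes> e \<otimes> z \<in> J'" using D z by blast
        then show "y \<otimes> r \<otimes> (e \<otimes> z) \<in> J'" using Cc[OF y(2)] r ec Cc[OF z] by (simp add: m_assoc)
      qed
      then show "q \<otimes> e \<otimes> z \<in> S" using q(1) ec Cc[OF z] by (simp add: m_assoc)
    qed
  qed
  have "x \<in> J'" if x: "x \<in> J" for x
  proof -
    note xS = closed_idealD(1)[OF J(1) x]
    \<comment> \<open>The modular law up to closure: if \<open>x s = j + y\<close>, then
      \<open>y = x s - j\<close> lies in both \<open>J\<close> and \<open>C\<close>, hence in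
      \<open>J'\<close>.\<close>
    have "\<one> \<in> {s \<in> S. x \<otimes> s \<in> J'}"
    proof (rule closureD[OF subsetD[OF A x] S_closed(2) closed_residual[OF J(2) xS]])
      fix s assume s: "s \<in> S" "x \<otimes> \<one> \<otimes> s \<in> {j \<oplus> y |j y. j \<in> J' \<and> y \<in> C}"
      then obtain j y where jy: "x \<otimes> s = j \<oplus> y" "j \<in> J'" "y \<in> C" using xS by auto
      note jS = closed_idealD(1)[OF J(2) jy(2)]
      have "x \<otimes> s \<ominus> j \<in> J"
        using closed_ideal_minus[OF J(1) closed_idealD(4)[OF J(1) x s(1)]] jy(2) J(3) by blast
      moreover have "x \<otimes> s \<ominus> j = y"
        using jy(1) jS Cc[OF jy(3)] by (simp add: a_comm[of j y] minus_eq a_assoc r_neg)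
      ultimately have "y \<in> J'" using inter jy(3) by simp
      then have "x \<otimes> s \<in> J'" using closed_idealD(3)[OF J(2) jy(2)] jy(1) by simp
      then show "s \<in> {s \<in> S. x \<otimes> s \<in> J'}" using s(1) by simp
    qed
    then show ?thesis using xS by simp
  qed
  then show ?thesis using J(3) by blast
qed

lemma right_ideal_sum:
  assumes J: "closed_ideal J" and C: "ideal C S_ring"
  shows "right_ideal {j \<oplus> y |j y. j \<in> J \<and> y \<in> C} S_ring" (is "right_ideal ?X S_ring")
  unfolding right_ideal_iff
proof (intro conjI ballI subsetI)
  note JS = closed_idealD(1)[OF J] and CS = idealD(1)[OF C]
  show "x \<in> S" if "x \<in> ?X" for x using that JS CS by auto
  have "\<zero> = \<zero> \<oplus> \<zero>" by simp
  then show "\<zero> \<in> ?X" using closed_idealD(2)[OF J] idealD(2)[OF C] by blast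
  fix x assume "x \<in> ?X"
  then obtain j y where x: "x = j \<oplus> y" "j \<in> J" "y \<in> C" by blast
  show "x \<oplus> x' \<in> ?X" if x'X: "x' \<in> ?X" for x'
  proof -
    obtain j' y' where x': "x' = j' \<oplus> y'" "j' \<in> J" "y' \<in> C" using x'X by blast
    have "x \<oplus> x' = (j \<oplus> j') \<oplus> (y \<oplus> y')" using x x' JS CS by (simp add: a_ac)
    then show ?thesis using closed_idealD(3)[OF J x(2) x'(2)] idealD(3)[OF C x(3) x'(3)] by blast
  qed
  show "x \<otimes> r \<in> ?X" if r: "r \<in> S" for r
  proof -
    have "x \<otimes> r = j \<otimes> r \<oplus> y \<otimes> r" using x JS CS r by (simp add: l_distr)
    then show ?thesis using closed_idealD(4)[OF J x(2) r] idealD(4)[OF C x(3) r] by blast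
  qed
qed

text \<open>\<open>P C \<subseteq> I\<close> places \<open>P\<close> below every \<open>D i\<close>,
  so the bound for \<open>P\<close> applies to the chain of left multipliers.\<close>

lemma chain_bound_extend:
  assumes I: "ideal I S_ring" and P: "ideal P S_ring" and C: "ideal C S_ring" "C \<noteq> {\<zero>}"
    and PC: "\<And>p x. p \<in> P \<Longrightarrow> x \<in> C \<Longrightarrow> p \<otimes> x \<in> I"
    and bounds: "chain_bound C n" "chain_bound P n'"
  shows "chain_bound I (n + n')"
proof (rule chain_boundI)
  fix J m
  assume J: "\<And>i. closed_ideal (J i)" "\<And>i. J (Suc i) \<subseteq> J i" "\<And>i. I \<subseteq> J i"
  define X where "X i = {j \<oplus> y |j y. j \<in> J i \<and> y \<in> C}" for i
  define D where "D i = {x \<in> S. \<forall>y\<in>C. x \<otimes> y \<in> J i}" for i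
  have X: "right_ideal (X i) S_ring" for i unfolding X_def by (rule right_ideal_sum[OF J(1) C(1)])
  have JX: "J i \<subseteq> X i" for i
  proof
    fix x assume x: "x \<in> J i"
    then have "x = x \<oplus> \<zero>" using closed_idealD(1)[OF J(1) x] by simp
    then show "x \<in> X i" using x idealD(2)[OF C(1)] unfolding X_def by blast
  qed
  have CX: "C \<subseteq> X i" for i
  proof
    fix x assume x: "x \<in> C"
    then have "x = \<zero> \<oplus> x" using idealD(1)[OF C(1) x] by simp
    then show "x \<in> X i" using x closed_idealD(2)[OF J(1)] unfolding X_def by blast
  qed
  have "J (Suc i) = J i" if "closure (X (Suc i)) = closure (X i)" "D (Suc i) = D i" for i
    using closed_chain_step[OF C J(1) J(1) J(2), of i] that JX[of i] subset_closure[OF X, of i]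
    unfolding X_def D_def by blast
  then have "{i. i < m \<and> J (Suc i) \<noteq> J i} \<subseteq>
      {i. i < m \<and> closure (X (Suc i)) \<noteq> closure (X i)} \<union> {i. i < m \<and> D (Suc i) \<noteq> D i}" by blast
  then have "card {i. i < m \<and> J (Suc i) \<noteq> J i} \<le>
      card ({i. i < m \<and> closure (X (Suc i)) \<noteq> closure (X i)} \<union> {i. i < m \<and> D (Suc i) \<noteq> D i})"
    by (intro card_mono) auto
  also have "\<dots> \<le> card {i. i < m \<and> closure (X (Suc i)) \<noteq> closure (X i)} +
      card {i. i < m \<and> D (Suc i) \<noteq> D i}" by (rule card_Un_le)
  also have "\<dots> \<le> n + n'"
  proof (rule add_mono)
    show "card {i. i < m \<and> closure (X (Suc i)) \<noteq> closure (X i)} \<le> n"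
    proof (rule chain_boundD[OF bounds(1)])
      show "closed_ideal (closure (X i))" for i by (rule closed_closure[OF X])
      have "X (Suc i) \<subseteq> X i" for i using J(2)[of i] unfolding X_def by blast
      then show "closure (X (Suc i)) \<subseteq> closure (X i)" for i by (rule closure_mono)
      show "C \<subseteq> closure (X i)" for i using CX subset_closure[OF X] by blast
    qed
    show "card {i. i < m \<and> D (Suc i) \<noteq> D i} \<le> n'"
    proof (rule chain_boundD[OF bounds(2)])
      show "closed_ideal (D i)" for i unfolding D_def by (rule closed_left_multipliers[OF C J(1)])
      show "D (Suc i) \<subseteq> D i" for i using J(2)[of i] unfolding D_def by blast
      show "P \<subseteq> D i" for i using PC J(3) idealD(1)[OF P] unfolding D_def by blast
    qed
  qed
  finally show "card {i. i < m \<and> J (Suc i) \<noteq> J i} \<le> n + n'" .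
qed

section \<open>Noetherian induction on divisorial ideals and bounds for factorizations\<close>

lemma ex_maximal_divisorial:
  assumes "divisorial_ideal Q S I" "I \<noteq> S"
  shows "\<exists>P. divisorial_ideal Q S P \<and> I \<subseteq> P \<and> P \<noteq> S \<and>
    (\<forall>P'. divisorial_ideal Q S P' \<longrightarrow> P \<subset> P' \<longrightarrow> P' = S)"
proof -
  have "I \<in> {I. divisorial_ideal Q S I}" using assms(1) by simp
  from acc_divisorial this show ?thesis
    using assms(2)
  proof (induction I rule: acc_induct)
    case (step I)
    show ?case
    proof (cases "\<exists>P'. divisorial_ideal Q S P' \<and> I \<subset> P' \<and> P' \<noteq> S")
      case True
      then obtain P' where P': "divisorial_ideal Q S P'" "I \<subset> P'" "P' \<noteq> S" by blast
      have "P' \<in> {I. divisorial_ideal Q S I}" using P'(1) by simp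
      from step.IH[OF this P'(2,3)] obtain P
        where "divisorial_ideal Q S P" "P' \<subseteq> P" "P \<noteq> S"
          "\<forall>P'. divisorial_ideal Q S P' \<longrightarrow> P \<subset> P' \<longrightarrow> P' = S" by blast
      moreover have "I \<subseteq> P" using P'(2) \<open>P' \<subseteq> P\<close> by simp
      ultimately show ?thesis by blast
    next
      case False
      then have "\<forall>P'. divisorial_ideal Q S P' \<longrightarrow> I \<subset> P' \<longrightarrow> P' = S" by blast
      then show ?thesis using step.hyps step.prems by blast
    qed
  qed
qed

lemma ex_chain_bound:
  assumes "divisorial_ideal Q S I"
  shows "\<exists>n. chain_bound I n"
proof -
  have "I \<in> {I. divisorial_ideal Q S I}" using assms(1) by simp
  from acc_divisorial this show ?thesis
  proof (induction I rule: acc_induct)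
    case (step I)
    then have I: "divisorial_ideal Q S I" by simp
    show ?case
    proof (cases "I = S")
      case True
      have "chain_bound S 0"
      proof (rule chain_boundI)
        fix J :: "nat \<Rightarrow> 'a set" and m
        assume J: "\<And>i. closed_ideal (J i)" "\<And>i. S \<subseteq> J i"
        have "J i = S" for i using closed_idealD(1)[OF J(1)] J(2) by blast
        then show "card {i. i < m \<and> J (Suc i) \<noteq> J i} \<le> 0" by simp
      qed
      then show ?thesis using True by blast
    next
      case False
      obtain P where P: "divisorial_ideal Q S P" "I \<subseteq> P" "P \<noteq> S"
          and max: "\<And>P'. divisorial_ideal Q S P' \<Longrightarrow> P \<subset> P' \<Longrightarrow> P' = S"
        using ex_maximal_divisorial[OF I False] by blast
      let ?C = "{x \<in> S. \<forall>p\<in>P. p \<otimes> x \<in> I}"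
      note C = divisorial_colon[OF P(1,3) I P(2)]
      have "?C \<in> {I. divisorial_ideal Q S I}" using C(1) by (rule CollectI)
      from step.IH[OF this C(2)] obtain n where "chain_bound ?C n" by blast
      \<comment> \<open>Each passage to a larger colon ideal costs \<open>d\<close>, and the process
        ends at \<open>S\<close>, where chains are constant.\<close>
      then have "chain_bound I (n + d)"
        by (intro chain_bound_extend[OF divisorialD(1)[OF I] divisorialD(1)[OF P(1)]
            divisorialD(1,2)[OF C(1)]] chain_bound_maximal[OF P(1,3) max]) auto
      then show ?thesis by blast
    qed
  qed
qed

text \<open>Nonunits are described by the lack of a right inverse in \<open>S\<close>, since
  equality of two consecutive right ideals \<open>pr (take i us) S\<close> gives exactly such an
  inverse after cancellation in \<open>Q\<close>.\<close>

lemma ex_factorization_bound: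
  assumes a: "a \<in> S" "a \<in> Units Q"
  shows "\<exists>n. \<forall>us. set us \<subseteq> S \<inter> Units Q \<and> (\<forall>u\<in>set us. \<forall>s\<in>S. u \<otimes> s \<noteq> \<one>) \<and>
    foldr (\<otimes>) us \<one> = a \<longrightarrow> length us \<le> n"
proof -
  obtain N where N: "ideal N S_ring" "N \<noteq> {\<zero>}" "N \<subseteq> {a \<otimes> s |s. s \<in> S}"
    by (rule principal_contains_ideal[OF a])
  have clN: "cl N \<subseteq> {a \<otimes> s |s. s \<in> S}"
  proof
    fix x assume x: "x \<in> cl N"
    note xS = cl_subset_S[OF N(1) x]
    \<comment> \<open>Elements of \<open>dual N\<close> remain in the dual of \<open>cl N\<close>,
      so \<open>inv a N \<subseteq> S\<close> extends to \<open>cl N\<close>.\<close>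
    have "inv a \<in> dual N"
    proof (rule dualI)
      fix y assume "y \<in> N"
      then obtain s where "y = a \<otimes> s" "s \<in> S" using N(3) by blast
      then show "inv a \<otimes> y \<in> S" using a by (simp add: m_assoc[symmetric])
    qed (use a in simp)
    then have "inv a \<in> dual (cl N)"
      using clD(1) dualD(1) by (intro dualI_r[OF ideal_cl[OF N(1,2)]]) simp_all
    then have "inv a \<otimes> x \<in> S" using x by (rule dualD(2))
    moreover have "x = a \<otimes> (inv a \<otimes> x)" using a xS by (simp add: m_assoc[symmetric])
    ultimately show "x \<in> {a \<otimes> s |s. s \<in> S}" by blast
  qed
  obtain n where n: "chain_bound (cl N) n" using ex_chain_bound[OF divisorial_cl[OF N(1,2)]] by blast
  have "length us \<le> n"
    if us: "set us \<subseteq> S \<inter> Units Q" and nonunit: "\<And>u s. u \<in> set us \<Longrightarrow> s \<in> S \<Longrightarrow> u \<otimes> s \<noteq> \<one>"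
      and prod: "foldr (\<otimes>) us \<one> = a" for us
  proof -
    define pr where "pr vs = foldr (\<otimes>) vs \<one>" for vs
    have pr_S: "pr vs \<in> S \<inter> Units Q" if "set vs \<subseteq> S \<inter> Units Q" for vs
      using that by (induction vs) (auto simp: pr_def)
    have pr_append: "pr (vs @ ws) = pr vs \<otimes> pr ws"
      if "set vs \<subseteq> S \<inter> Units Q" "set ws \<subseteq> S \<inter> Units Q" for vs ws
      using that(1)
    proof (induction vs)
      case Nil
      then show ?case using pr_S[OF that(2)] by (simp add: pr_def)
    next
      case (Cons v vs)
      then have "pr vs \<in> S \<inter> Units Q" "v \<in> S" using pr_S by auto
      then show ?case using Cons pr_S[OF that(2)] by (simp add: pr_def m_assoc)
    qed
    define J where "J i = {pr (take i us) \<otimes> s |s. s \<in> S}" for i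
    have tk: "set (take i us) \<subseteq> S \<inter> Units Q" "set (drop i us) \<subseteq> S \<inter> Units Q" for i
      using us set_take_subset[of i us] set_drop_subset[of i us] by blast+
    have pt: "pr (take i us) \<in> S" "pr (take i us) \<in> Units Q" for i using pr_S[OF tk(1)] by auto
    have Suc_take: "pr (take (Suc i) us) = pr (take i us) \<otimes> us ! i" "us ! i \<in> S" if "i < length us" for i
    proof -
      have u: "us ! i \<in> set us" using that by simp
      then show "us ! i \<in> S" using us by blast
      have "pr (take i us @ [us ! i]) = pr (take i us) \<otimes> pr [us ! i]"
        by (rule pr_append[OF tk(1)]) (use u us in auto)
      moreover have "pr [us ! i] = us ! i" using u us by (auto simp: pr_def)
      ultimately show "pr (take (Suc i) us) = pr (take i us) \<otimes> us ! i"
        using that by (simp add: take_Suc_conv_app_nth)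
    qed
    have step: "J (Suc i) \<noteq> J i" if i: "i < length us" for i
    proof
      assume "J (Suc i) = J i"
      moreover have "pr (take i us) = pr (take i us) \<otimes> \<one>" using pt by simp
      then have "pr (take i us) \<in> J i" unfolding J_def using S_closed(2) by blast
      ultimately obtain s where s: "s \<in> S" "pr (take i us) = pr (take (Suc i) us) \<otimes> s"
        unfolding J_def by blast
      then have "pr (take i us) \<otimes> (us ! i \<otimes> s) = pr (take i us) \<otimes> \<one>"
        using Suc_take[OF i] pt by (simp add: m_assoc)
      then have "us ! i \<otimes> s = \<one>" using Units_l_cancel[OF pt(2)] Suc_take(2)[OF i] s(1) by simp
      then show False using nonunit[OF nth_mem[OF i] s(1)] by simp
    qed
    have "{i. i < length us \<and> J (Suc i) \<noteq> J i} = {..<length us}" using step by blast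
    moreover have "card {i. i < length us \<and> J (Suc i) \<noteq> J i} \<le> n"
    proof (rule chain_boundD[OF n])
      show "closed_ideal (J i)" for i unfolding J_def by (rule closed_principal[OF pt])
      \<comment> \<open>Past the end of the list \<open>take\<close> is stationary, which extends
        the finite chain to an infinite sequence.\<close>
      show "J (Suc i) \<subseteq> J i" for i
      proof (cases "i < length us")
        case True
        show ?thesis
        proof
          fix x assume "x \<in> J (Suc i)"
          then obtain s where s: "s \<in> S" "x = pr (take (Suc i) us) \<otimes> s" unfolding J_def by blast
          then have "x = pr (take i us) \<otimes> (us ! i \<otimes> s)" "us ! i \<otimes> s \<in> S"
            using Suc_take[OF True] pt by (simp_all add: m_assoc)
          then show "x \<in> J i" unfolding J_def by blast
        qed
      qed (simp add: J_def)
      show "cl N \<subseteq> J i" for i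
      proof
        fix x assume "x \<in> cl N"
        then obtain s where s: "s \<in> S" "x = a \<otimes> s" using clN by blast
        have "a = pr (take i us) \<otimes> pr (drop i us)"
          using pr_append[OF tk, of i i] prod by (simp add: pr_def)
        then have "x = pr (take i us) \<otimes> (pr (drop i us) \<otimes> s)" "pr (drop i us) \<otimes> s \<in> S"
          using s pt pr_S[OF tk(2)[of i]] by (simp_all add: m_assoc)
        then show "x \<in> J i" unfolding J_def by blast
      qed
    qed
    ultimately show ?thesis by simp
  qed
  then show ?thesis by blast
qed

end

section \<open>Lengths of factorizations\<close>

text \<open>A longest factorization into nonunits consists of atoms, since a factor that is not an
  atom splits into two nonunits and would give a longer one.\<close>

lemma (in monoid) set_of_lengths_bounded:
  assumes a: "a \<in> carrier G"
    and bound: "\<And>us. set us \<subseteq> carrier G - Units G \<Longrightarrow> foldr (\<otimes>) us \<one> = a \<Longrightarrow> length us \<le> n"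
  shows "finite (set_of_lengths G a) \<and> set_of_lengths G a \<noteq> {}"
proof (cases "a \<in> Units G")
  case True
  then show ?thesis by (simp add: set_of_lengths_def)
next
  case False
  define fact where "fact us \<longleftrightarrow> set us \<subseteq> carrier G - Units G \<and> foldr (\<otimes>) us \<one> = a" for us
  have lengths: "set_of_lengths G a = {length us |us. set us \<subseteq> atoms G \<and> a = foldr (\<otimes>) us \<one>}"
    using False by (simp add: set_of_lengths_def)
  have atoms: "atoms G \<subseteq> carrier G - Units G" by (auto simp: atoms_def)
  have "set_of_lengths G a \<subseteq> {..n}" unfolding lengths using atoms bound by blast
  then have "finite (set_of_lengths G a)" by (rule finite_subset) simp
  moreover have "\<exists>us. fact us \<and> (\<forall>vs. fact vs \<longrightarrow> length vs \<le> length us)"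
  proof (rule ex_has_greatest_nat[where f = length])
    show "fact [a]" using a False by (simp add: fact_def)
    \<comment> \<open>The greatest-element rule takes a strict bound, hence
      \<open>Suc n\<close>.\<close>
    show "\<forall>vs. fact vs \<longrightarrow> length vs < Suc n" using bound by (simp add: fact_def less_Suc_eq_le)
  qed
  then obtain us where us: "fact us" and longest: "\<And>vs. fact vs \<Longrightarrow> length vs \<le> length us" by blast
  have "u \<in> atoms G" if u: "u \<in> set us" for u
  proof (rule ccontr)
    assume "u \<notin> atoms G"
    moreover have "u \<in> carrier G - Units G" using us u by (auto simp: fact_def)
    ultimately obtain b c where bc: "b \<in> carrier G - Units G" "c \<in> carrier G - Units G" "u = b \<otimes> c"
      by (auto simp: atoms_def)
    obtain xs ys where split: "us = xs @ u # ys" using split_list[OF u] by blast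
    have "foldr (\<otimes>) vs \<one> \<in> carrier G" if "set vs \<subseteq> carrier G - Units G" for vs
      using that by (induction vs) auto
    then have "foldr (\<otimes>) ys \<one> \<in> carrier G" using us split by (simp add: fact_def)
    then have "fact (xs @ b # c # ys)" using us bc by (auto simp: fact_def split m_assoc)
    then show False using longest split by fastforce
  qed
  then have "length us \<in> set_of_lengths G a" unfolding lengths using us by (auto simp: fact_def)
  ultimately show ?thesis by blast
qed

section \<open>Transfer from \<open>R\<close> to its image in the quotient ring\<close>

lemma (in ring) nonzerodiv_right_inverse_Units:
  assumes u: "u \<in> nonzerodivs R" and s: "s \<in> carrier R" "u \<otimes> s = \<one>"
  shows "u \<in> Units R"
proof -
  note uc = nonzerodivsD(1)[OF u]
  have "u \<otimes> (s \<otimes> u \<ominus> \<one>) = (u \<otimes> s) \<otimes> u \<ominus> u"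
    using uc s(1) by (simp add: minus_eq r_distr r_minus m_assoc)
  also have "\<dots> = \<zero>" using s(2) uc by (simp add: minus_eq r_neg)
  finally have "s \<otimes> u \<ominus> \<one> = \<zero>" using nonzerodivsD(2)[OF u] uc s(1) by simp
  then have "s \<otimes> u = \<one>" using uc s(1) by simp
  then show ?thesis using uc s by (auto simp: Units_def)
qed

text \<open>Absorption passes to the image \<open>S\<close> by taking preimages of \<open>K\<close>
  and of the right ideals under \<open>\<iota>\<close>, without evaluating polynomials in
  \<open>Q\<close>. Conversely, a right inverse in \<open>S\<close> of the image of a regular
  element pulls back by injectivity and would make that element a unit of \<open>R\<close>.\<close>

lemma pi_krull_factorization_bound:
  assumes R: "pi_krull_ring R" and a: "a \<in> nonzerodivs R"
  shows "\<exists>n. \<forall>us. set us \<subseteq> nonzerodivs R - Units R \<and> foldr (\<otimes>\<^bsub>R\<^esub>) us \<one>\<^bsub>R\<^esub> = a \<longrightarrow> length us \<le> n"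
proof -
  have pi: "pi_ring R" and prime: "prime_ring R" and krull: "krull_ring R"
    using R by (auto simp: pi_krull_ring_def krull_ring_def)
  obtain Q :: "('a \<times> 'a) set ring" and \<iota> where quot: "quotient_ring R Q \<iota>"
    and cic: "completely_integrally_closed Q (\<iota> ` carrier R)"
    and acc: "acc {I. divisorial_ideal Q (\<iota> ` carrier R) I}"
    using krull unfolding krull_ring_def by blast
  interpret R: ring R using prime by (simp add: prime_ring_def)
  interpret Q: ring Q using quot by (simp add: quotient_ring_def)
  have hom: "\<iota> \<in> ring_hom R Q" and inj: "inj_on \<iota> (carrier R)"
    and units: "\<And>u. u \<in> nonzerodivs R \<Longrightarrow> \<iota> u \<in> Units Q"
    using quot by (auto simp: quotient_ring_def)
  interpret hom: ring_hom_ring R Q \<iota> by (rule ring_hom_ringI2[OF R.ring_axioms Q.ring_axioms hom])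
  define S where "S = \<iota> ` carrier R"
  interpret order: cic_order Q S
  proof (intro cic_order.intro cic_order_axioms.intro Q.ring_axioms)
    show "subring S Q" unfolding S_def by (rule hom.img_is_subring[OF R.carrier_is_subring])
    show "completely_integrally_closed Q S" using cic by (simp add: S_def)
  qed
  obtain d where absorb: "absorbing R d" using R.pi_ring_absorbing[OF pi] by blast
  interpret krull: pi_krull_order Q S d
  proof
    show "\<one>\<^bsub>Q\<^esub> \<noteq> \<zero>\<^bsub>Q\<^esub>"
    proof
      assume "\<one>\<^bsub>Q\<^esub> = \<zero>\<^bsub>Q\<^esub>"
      then have "\<iota> \<one>\<^bsub>R\<^esub> = \<iota> \<zero>\<^bsub>R\<^esub>" by simp
      then have "\<one>\<^bsub>R\<^esub> = \<zero>\<^bsub>R\<^esub>" using inj_onD[OF inj] by blast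
      then show False using prime by (simp add: prime_ring_def)
    qed
    show "acc {I. divisorial_ideal Q S I}" using acc by (simp add: S_def)
    show "absorbing (Q\<lparr>carrier := S\<rparr>) d"
    proof (rule absorbingI)
      fix t :: "nat \<Rightarrow> ('a \<times> 'a) set" and T K
      let ?S = "Q\<lparr>carrier := S\<rparr>"
      assume "\<And>k. k < d \<Longrightarrow> t k \<in> carrier ?S" and T: "\<And>k. k < d \<Longrightarrow> right_ideal (T k) ?S"
        and K: "\<And>k. k < d \<Longrightarrow> K \<subseteq> T k" and tT: "\<And>k j. k < j \<Longrightarrow> j < d \<Longrightarrow> t j \<in> T k"
        and "\<zero>\<^bsub>?S\<^esub> \<in> K" "\<one>\<^bsub>?S\<^esub> \<notin> K"
      then have t: "\<And>k. k < d \<Longrightarrow> t k \<in> S" and K01: "\<zero>\<^bsub>Q\<^esub> \<in> K" "\<one>\<^bsub>Q\<^esub> \<notin> K" by simp_all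
      have "\<exists>x. x \<in> carrier R \<and> \<iota> x = t k" if "k < d" for k using t[OF that] by (auto simp: S_def)
      then obtain t' where t': "\<And>k. k < d \<Longrightarrow> t' k \<in> carrier R" "\<And>k. k < d \<Longrightarrow> \<iota> (t' k) = t k" by metis
      define pre where "pre X = {x \<in> carrier R. \<iota> x \<in> X}" for X
      have "\<exists>k<d. \<exists>g\<in>carrier R - pre K. \<forall>r\<in>carrier R. t' k \<otimes>\<^bsub>R\<^esub> r \<otimes>\<^bsub>R\<^esub> g \<in> pre (T k)"
      proof (rule absorbingD[OF absorb])
        fix k assume k: "k < d"
        have Tk: "\<zero>\<^bsub>Q\<^esub> \<in> T k" "\<And>x y. x \<in> T k \<Longrightarrow> y \<in> T k \<Longrightarrow> x \<oplus>\<^bsub>Q\<^esub> y \<in> T k"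
          "\<And>x r. x \<in> T k \<Longrightarrow> r \<in> carrier R \<Longrightarrow> x \<otimes>\<^bsub>Q\<^esub> \<iota> r \<in> T k"
          using T[OF k, unfolded order.right_ideal_iff] by (simp_all add: S_def)
        have mult: "x \<otimes>\<^bsub>R\<^esub> r \<in> pre (T k)" if "x \<in> pre (T k)" "r \<in> carrier R" for x r
          using that Tk(3) by (simp add: pre_def)
        have "subgroup (pre (T k)) (add_monoid R)"
        proof (rule R.add.subgroupI)
          show "pre (T k) \<subseteq> carrier R" by (auto simp: pre_def)
          have "\<zero>\<^bsub>R\<^esub> \<in> pre (T k)" using Tk(1) by (simp add: pre_def)
          then show "pre (T k) \<noteq> {}" by blast
          show "\<ominus>\<^bsub>R\<^esub> x \<in> pre (T k)" if "x \<in> pre (T k)" for x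
          proof -
            have "x \<in> carrier R" using that by (simp add: pre_def)
            then show ?thesis using mult[OF that, of "\<ominus>\<^bsub>R\<^esub> \<one>\<^bsub>R\<^esub>"] by (simp add: R.r_minus)
          qed
          show "x \<oplus>\<^bsub>R\<^esub> y \<in> pre (T k)" if "x \<in> pre (T k)" "y \<in> pre (T k)" for x y
            using that Tk(2) by (simp add: pre_def)
        qed
        then show "right_ideal (pre (T k)) R"
          using mult by (simp add: right_ideal_def additive_subgroup_def)
        show "pre K \<subseteq> pre (T k)" using K[OF k] by (auto simp: pre_def)
        show "t' k \<in> carrier R" by (rule t'(1)[OF k])
      next
        fix k j assume "k < j" "j < d"
        then show "t' j \<in> pre (T k)" using t' tT by (simp add: pre_def)
      qed (use K01 in \<open>simp_all add: pre_def\<close>)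
      then obtain k g where k: "k < d" and g: "g \<in> carrier R" "g \<notin> pre K"
        and tg: "\<And>r. r \<in> carrier R \<Longrightarrow> t' k \<otimes>\<^bsub>R\<^esub> r \<otimes>\<^bsub>R\<^esub> g \<in> pre (T k)" by blast
      have "t k \<otimes>\<^bsub>Q\<^esub> r \<otimes>\<^bsub>Q\<^esub> \<iota> g \<in> T k" if rS: "r \<in> S" for r
      proof -
        obtain r' where r': "r' \<in> carrier R" "r = \<iota> r'" using rS by (auto simp: S_def)
        then show ?thesis using tg[OF r'(1)] t'[OF k] g(1) by (simp add: pre_def)
      qed
      moreover have "\<iota> g \<in> S - K" using g by (auto simp: S_def pre_def)
      ultimately have "\<exists>k<d. \<exists>g\<in>S - K. \<forall>r\<in>S. t k \<otimes>\<^bsub>Q\<^esub> r \<otimes>\<^bsub>Q\<^esub> g \<in> T k" using k by blast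
      then show "\<exists>k<d. \<exists>g\<in>carrier ?S - K. \<forall>r\<in>carrier ?S. t k \<otimes>\<^bsub>?S\<^esub> r \<otimes>\<^bsub>?S\<^esub> g \<in> T k" by simp
    qed
  qed
  have "\<iota> a \<in> S" using nonzerodivsD(1)[OF a] by (simp add: S_def)
  from krull.ex_factorization_bound[OF this units[OF a]] obtain n
    where n: "\<And>us. set us \<subseteq> S \<inter> Units Q \<Longrightarrow> (\<forall>u\<in>set us. \<forall>s\<in>S. u \<otimes>\<^bsub>Q\<^esub> s \<noteq> \<one>\<^bsub>Q\<^esub>) \<Longrightarrow>
      foldr (\<otimes>\<^bsub>Q\<^esub>) us \<one>\<^bsub>Q\<^esub> = \<iota> a \<Longrightarrow> length us \<le> n" by blast
  have "length us \<le> n"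
    if us: "set us \<subseteq> nonzerodivs R - Units R" and prod: "foldr (\<otimes>\<^bsub>R\<^esub>) us \<one>\<^bsub>R\<^esub> = a" for us
  proof -
    have c: "u \<in> carrier R" if "u \<in> set us" for u
    proof (rule nonzerodivsD(1))
      show "u \<in> nonzerodivs R" using us that by blast
    qed
    have "foldr (\<otimes>\<^bsub>R\<^esub>) vs \<one>\<^bsub>R\<^esub> \<in> carrier R \<and>
        \<iota> (foldr (\<otimes>\<^bsub>R\<^esub>) vs \<one>\<^bsub>R\<^esub>) = foldr (\<otimes>\<^bsub>Q\<^esub>) (map \<iota> vs) \<one>\<^bsub>Q\<^esub>" if "set vs \<subseteq> carrier R" for vs
      using that by (induction vs) auto
    then have "foldr (\<otimes>\<^bsub>Q\<^esub>) (map \<iota> us) \<one>\<^bsub>Q\<^esub> = \<iota> a" using c prod by auto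
    moreover have "set (map \<iota> us) \<subseteq> S \<inter> Units Q" using us c units by (auto simp: S_def)
    moreover have "\<iota> u \<otimes>\<^bsub>Q\<^esub> \<iota> s \<noteq> \<one>\<^bsub>Q\<^esub>" if u: "u \<in> set us" and s: "s \<in> carrier R" for u s
    proof
      assume "\<iota> u \<otimes>\<^bsub>Q\<^esub> \<iota> s = \<one>\<^bsub>Q\<^esub>"
      then have "\<iota> (u \<otimes>\<^bsub>R\<^esub> s) = \<iota> \<one>\<^bsub>R\<^esub>" using c[OF u] s by simp
      then have "u \<otimes>\<^bsub>R\<^esub> s = \<one>\<^bsub>R\<^esub>" using inj_onD[OF inj] c[OF u] s by simp
      then show False using R.nonzerodiv_right_inverse_Units[OF _ s] us u by blast
    qed
    ultimately have "length (map \<iota> us) \<le> n" by (intro n) (auto simp: S_def)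
    then show ?thesis by simp
  qed
  then show ?thesis by blast
qed

theorem corollary5p29:
  fixes R :: "('a, 'm) ring_scheme"
  assumes "pi_krull_ring R"
  shows "\<forall>a \<in> carrier (regular_monoid R).
    finite (set_of_lengths (regular_monoid R) a) \<and> set_of_lengths (regular_monoid R) a \<noteq> {}"
proof
  fix a assume "a \<in> carrier (regular_monoid R)"
  then have a: "a \<in> nonzerodivs R" by (simp add: regular_monoid_def)
  interpret R: ring R using assms by (simp add: pi_krull_ring_def pi_ring_def)
  interpret M: monoid "regular_monoid R" by (rule R.monoid_regular_monoid)
  obtain n where "\<And>us. set us \<subseteq> nonzerodivs R - Units R \<Longrightarrow>
      foldr (\<otimes>\<^bsub>R\<^esub>) us \<one>\<^bsub>R\<^esub> = a \<Longrightarrow> length us \<le> n"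
    using pi_krull_factorization_bound[OF assms a] by blast
  then show "finite (set_of_lengths (regular_monoid R) a) \<and> set_of_lengths (regular_monoid R) a \<noteq> {}"
    using a by (intro M.set_of_lengths_bounded)
      (simp_all add: R.Units_regular_monoid, simp_all add: regular_monoid_def)
qed

end
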